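(* Let $d\ge1$, $\mu>-\frac12$, $\beta>-d$ with $2\mu+\beta+d>0$. The polynomials $\mathsf{U}^{\mathsf L}_{\mathbf k,n}$ and $\mathsf{V}^{\mathsf L}_{\mathbf j,n}$ are partially biorthogonal in the sense that, for $\mathbf k,\mathbf j\in\mathbb{N}_0^d$ with $k=|\mathbf k|\le n$ and $j=|\mathbf j|\le n$, the relation $$b^L_{\beta,\mu}\int_{\mathbb{V}^{d+1}}\mathsf{U}^{\mathsf L}_{\mathbf k,n}(x,t)\,\mathsf{V}^{\mathsf L}_{\mathbf j,n}(x,t)\,W_{\beta,\mu}(x,t)\,dx\,dt=\mathbf k!\,(n-k)!\,(-1)^n(2\mu+\beta+d)_{n+k}\,\frac{(\mu+\frac12)_k}{(\mu+\frac{d+1}2)_k}\,\delta_{\mathbf k,\mathbf j}$$ holds if either $k\ge j$, or $j>k$ and $\mathbf j-\mathbf k$ has an odd component.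
   Context: $\mathbb{V}^{d+1}=\{(x,t):\|x\|\le t,\ x\in\mathbb{R}^d,\ 0\le t<\infty\}$, $W_{\beta,\mu}(x,t)=(t^2-\|x\|^2)^{\mu-\frac12}t^\beta e^{-t}$, and $b^L_{\beta,\mu}=\bigl(\int_{\mathbb{V}^{d+1}}W_{\beta,\mu}\,dx\,dt\bigr)^{-1}=\frac{1}{\Gamma(2\mu+\beta+d)}\frac{\Gamma(\mu+\frac{d+1}2)}{\pi^{d/2}\Gamma(\mu+\frac12)}$. $\mathcal{V}_n(\mathbb{V}^{d+1},W_{\beta,\mu})$ is the space of polynomials of degree at most $n$ in $(x,t)$ orthogonal to all polynomials of degree at most $n-1$ with respect to $\langle f,g\rangle=\int_{\mathbb{V}^{d+1}}fg\,W_{\beta,\mu}\,dx\,dt$. Notation: $|\mathbf k|=k_1+\cdots+k_d$, $\mathbf k!=k_1!\cdots k_d!$, $(a)_k=a(a+1)\cdots(a+k-1)$. For $\mathbf k\in\mathbb{N}_0^d$, $|\mathbf k|=k\le n$, $$\mathsf{U}^{\mathsf L}_{\mathbf k,n}(x,t)=\frac{1}{W_{\beta,\mu}(x,t)}\,\frac{1}{t^{2k+2\mu+d-1}}\left[\frac{\partial^{\mathbf k}}{\partial x^{\mathbf k}}(t^2-\|x\|^2)^{k+\mu-\frac12}\right]\left[\frac{\partial^{n-k}}{\partial t^{n-k}}\bigl(t^{n+k+\beta+2\mu+d-1}e^{-t}\bigr)\right].$$ $\mathsf{V}^{\mathsf L}_{\mathbf j,n}$, $|\mathbf j|\le n$,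 is the monomial orthogonal polynomial: the unique element of $\mathcal{V}_n(\mathbb{V}^{d+1},W_{\beta,\mu})$ such that $\mathsf{V}^{\mathsf L}_{\mathbf j,n}(x,t)-t^{n-|\mathbf j|}x^{\mathbf j}$ is a polynomial of degree at most $n-1$ in $(x,t)$. *)

theory Defs
  imports "HOL-Analysis.Analysis"
begin

text \<open>
  Points of the cone are pairs \<open>(x, t)\<close> with \<open>x :: real ^ 'n\<close> and \<open>d = CARD('n)\<close>;
  multi-indices are functions \<open>'n \<Rightarrow> nat\<close>.
\<close>

definition solid_cone :: "((real ^ 'n) \<times> real) set" where
  "solid_cone = {(x, t). norm x \<le> t}"

definition cone_integral :: "(real ^ 'n \<Rightarrow> real \<Rightarrow> real) \<Rightarrow> real" where
  "cone_integral f = (LINT z:solid_cone|lborel. f (fst z) (snd z))"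

definition weight :: "real \<Rightarrow> real \<Rightarrow> real ^ 'n \<Rightarrow> real \<Rightarrow> real" where
  "weight \<beta> \<mu> x t = (t\<^sup>2 - (norm x)\<^sup>2) powr (\<mu> - 1/2) * t powr \<beta> * exp (- t)"

definition norm_const :: "'n::finite itself \<Rightarrow> real \<Rightarrow> real \<Rightarrow> real" where
  "norm_const _ \<beta> \<mu> = inverse (cone_integral (weight \<beta> \<mu> :: real ^ 'n \<Rightarrow> real \<Rightarrow> real))"

definition weight_inner ::
  "real \<Rightarrow> real \<Rightarrow> (real ^ 'n \<Rightarrow> real \<Rightarrow> real) \<Rightarrow> (real ^ 'n \<Rightarrow> real \<Rightarrow> real) \<Rightarrow> real" where
  "weight_inner \<beta> \<mu> f g = cone_integral (\<lambda>x t. f x t * g x t * weight \<beta> \<mu> x t)"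

definition mdeg :: "('n::finite \<Rightarrow> nat) \<Rightarrow> nat" where
  "mdeg k = (\<Sum>i\<in>UNIV. k i)"

definition mfact :: "('n::finite \<Rightarrow> nat) \<Rightarrow> nat" where
  "mfact k = (\<Prod>i\<in>UNIV. fact (k i))"

definition mpow :: "real ^ 'n \<Rightarrow> ('n \<Rightarrow> nat) \<Rightarrow> real" where
  "mpow x k = (\<Prod>i\<in>UNIV. (x $ i) ^ k i)"

text \<open>
  Polynomials in \<open>(x, t)\<close> are polynomial functions. Bounding the total degree strictly makes
  \<open>polys_deg_less 0\<close> the zero space, which is what ``degree at most \<open>n - 1\<close>'' means for \<open>n = 0\<close>.
\<close>

definition polys_deg_less :: "nat \<Rightarrow> (real ^ 'n \<Rightarrow> real \<Rightarrow> real) set" where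
  "polys_deg_less m =
     {p. \<exists>c. p = (\<lambda>x t. \<Sum>(a, i) | mdeg a + i < m. c a i * mpow x a * t ^ i)}"

definition orth_polys :: "real \<Rightarrow> real \<Rightarrow> nat \<Rightarrow> (real ^ 'n \<Rightarrow> real \<Rightarrow> real) set" where
  "orth_polys \<beta> \<mu> n =
     {p \<in> polys_deg_less (Suc n). \<forall>q\<in>polys_deg_less n. weight_inner \<beta> \<mu> p q = 0}"

definition partial_deriv :: "'n \<Rightarrow> (real ^ 'n \<Rightarrow> real) \<Rightarrow> real ^ 'n \<Rightarrow> real" where
  "partial_deriv i f x = deriv (\<lambda>h. f (x + h *\<^sub>R axis i 1)) 0"

text \<open>
  A finite index type carries no canonical order, so the partial derivatives are composed along an
  arbitrary enumeration of the coordinates; for smooth functions the order is immaterial.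
\<close>

definition coords :: "'n::finite list" where
  "coords = (SOME xs. distinct xs \<and> set xs = UNIV)"

definition multi_deriv :: "('n::finite \<Rightarrow> nat) \<Rightarrow> (real ^ 'n \<Rightarrow> real) \<Rightarrow> real ^ 'n \<Rightarrow> real" where
  "multi_deriv k f = foldr (\<lambda>i. partial_deriv i ^^ k i) coords f"

text \<open>
  The Rodrigues formula below is meaningful in the interior of the cone; the boundary, where
  the quotient by the weight may take conventional values, is a null set.
\<close>

definition laguerre_U ::
  "real \<Rightarrow> real \<Rightarrow> ('n::finite \<Rightarrow> nat) \<Rightarrow> nat \<Rightarrow> real ^ 'n \<Rightarrow> real \<Rightarrow> real" where
  "laguerre_U \<beta> \<mu> k n x t =
     1 / weight \<beta> \<mu> x t
     * (1 / t powr (2 * real (mdeg k) + 2 * \<mu> + real CARD('n) - 1))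
     * multi_deriv k (\<lambda>y. (t\<^sup>2 - (norm y)\<^sup>2) powr (real (mdeg k) + \<mu> - 1/2)) x
     * (deriv ^^ (n - mdeg k))
         (\<lambda>s. s powr (real n + real (mdeg k) + \<beta> + 2 * \<mu> + real CARD('n) - 1) * exp (- s)) t"

definition laguerre_V ::
  "real \<Rightarrow> real \<Rightarrow> ('n::finite \<Rightarrow> nat) \<Rightarrow> nat \<Rightarrow> real ^ 'n \<Rightarrow> real \<Rightarrow> real" where
  "laguerre_V \<beta> \<mu> j n =
     (THE v. v \<in> orth_polys \<beta> \<mu> n \<and>
             (\<lambda>x t. v x t - t ^ (n - mdeg j) * mpow x j) \<in> polys_deg_less n)"

end

theory Submission
  imports Defs "HOL-Probability.Distributions"
begin

text \<open>
  In the coordinates \<open>x = t y\<close> the product of \<open>U\<^sub>k\<close> with the weight splits into a function of \<open>y\<close> on the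
  unit ball, namely \<open>\<partial>\<^sup>k (1 - |y|\<^sup>2)\<^sup>p\<close>, and a function of \<open>t\<close>, essentially an iterated derivative of
  \<open>t\<^sup>q e\<^sup>-\<^sup>t\<close>. Integrating by parts in both factors shows that \<open>U\<^sub>k\<close> is orthogonal to every monomial
  of degree less than \<open>n\<close>. Hence only the leading monomial \<open>t\<^sup>n\<^sup>-\<^sup>|\<^sup>j\<^sup>| x\<^sup>j\<close> of \<open>V\<^sub>j\<close> contributes; its
  integral vanishes if some \<open>j\<^sub>i < k\<^sub>i\<close>, or by parity if \<open>j - k\<close> has an odd component, and is explicit
  for \<open>j = k\<close>. Of \<open>V\<^sub>j\<close> one needs only that it exists uniquely, which follows from the
  definiteness of the inner product on polynomials.
\<close>

section \<open>Moments of the unit ball\<close>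

text \<open>The obstacle to integrating by parts is the sphere: |k| derivatives of (1 - |y|^2)^p
  with p = |k| + \<mu> - 1/2 leave exponents down to \<mu> - 1/2, which is negative for \<mu> < 1/2,
  and the power of t may likewise be singular at 0. The partial integrations are therefore
  identities between closed forms. Moments are Gamma expressions, derivatives are recorded as finite
  lists or polynomials, and each integration by parts reduces to Gamma(z + 1) = z Gamma(z).
  Convergence is then needed only for exponents above -1.

  In the t factor, the integral is a product of linear factors, one of which is zero for every power
  that is too low. If |k| \<ge> |j| and k \<noteq> j, some j_i < k_i, so the two vanishing
  mechanisms cover exactly the assumed cases.

  With s = 2 \<mu> + \<beta> + d, the symbol (s)_(n+k) is Gamma(s + n + k) / Gamma(s) from the t
  integral, and the quotient of (\<mu> + 1/2)_k and (\<mu> + (d+1)/2)_k compares ball moments with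
  exponents p and \<mu> - 1/2. The sign (-1)^n is (-1)^k from the ball times (-1)^(n-k) from the
  half line.\<close>

lemma has_bochner_integral_prod_Basis:
  fixes f :: "'a::euclidean_space \<Rightarrow> real \<Rightarrow> real"
  assumes f: "\<And>b. b \<in> Basis \<Longrightarrow> has_bochner_integral lborel (f b) (I b)"
  shows "has_bochner_integral lborel (\<lambda>x. \<Prod>b\<in>Basis. f b (x \<bullet> b)) (\<Prod>b\<in>Basis. I b)"
proof -
  interpret product_sigma_finite "\<lambda>_::'a. lborel :: real measure" ..
  have int: "integrable lborel (f b)" if "b \<in> Basis" for b
    using f[OF that] by (simp add: has_bochner_integral_iff)
  have [measurable]: "f b \<in> borel_measurable borel" if "b \<in> Basis" for b
    using int[OF that] by (auto dest: borel_measurable_integrable)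
  have m: "(\<lambda>x::'a. \<Prod>b\<in>Basis. f b (x \<bullet> b)) \<in> borel_measurable borel"
    by measurable
  have s: "(\<Sum>c\<in>Basis. x c *\<^sub>R c) \<bullet> b = x b" if "b \<in> Basis" for x and b :: 'a
    using that by simp
  have "has_bochner_integral (Pi\<^sub>M Basis (\<lambda>_. lborel)) (\<lambda>x. \<Prod>b\<in>Basis. f b (x b)) (\<Prod>b\<in>Basis. I b)"
    using product_integrable_prod[OF finite_Basis int] product_integral_prod[OF finite_Basis int] f
    by (simp add: has_bochner_integral_iff)
  then have "has_bochner_integral (Pi\<^sub>M Basis (\<lambda>_. lborel))
      (\<lambda>x. \<Prod>b\<in>Basis. f b ((\<Sum>c\<in>Basis. x c *\<^sub>R c) \<bullet> b)) (\<Prod>b\<in>Basis. I b)"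
    by (simp add: s)
  then have "has_bochner_integral (distr (Pi\<^sub>M Basis (\<lambda>_. lborel)) borel (\<lambda>f. \<Sum>b\<in>Basis. f b *\<^sub>R b))
      (\<lambda>x::'a. \<Prod>b\<in>Basis. f b (x \<bullet> b)) (\<Prod>b\<in>Basis. I b)"
    by (intro has_bochner_integral_distr m) (measurable)
  then show ?thesis
    by (simp add: lborel_eq[symmetric])
qed

lemma has_bochner_integral_prod_vec:
  fixes f :: "'n::finite \<Rightarrow> real \<Rightarrow> real"
  assumes f: "\<And>i. has_bochner_integral lborel (f i) (I i)"
  shows "has_bochner_integral lborel (\<lambda>x::real^'n. \<Prod>i\<in>UNIV. f i (x $ i)) (\<Prod>i\<in>UNIV. I i)"
proof -
  have B: "(Basis :: (real^'n) set) = (\<lambda>i. axis i 1) ` UNIV"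
    by (auto simp: Basis_vec_def)
  have inj: "inj (\<lambda>i::'n. axis i (1::real))"
    by (auto simp: inj_on_def axis_eq_axis)
  define g where "g b = inv (\<lambda>i::'n. axis i (1::real)) b" for b
  have g: "g (axis i 1) = i" for i
    unfolding g_def using inj by (rule inv_f_f)
  have "has_bochner_integral lborel (\<lambda>x::real^'n. \<Prod>b\<in>Basis. f (g b) (x \<bullet> b)) (\<Prod>b\<in>Basis. I (g b))"
    by (rule has_bochner_integral_prod_Basis) (rule f)
  then show ?thesis
    by (simp add: B prod.reindex[OF inj] g inner_axis)
qed

lemma
  fixes f :: "'a::euclidean_space \<Rightarrow> real"
  assumes c: "c > 0" and f[measurable]: "f \<in> borel_measurable borel"
  shows integrable_lborel_scaleR_iff: "integrable lborel (\<lambda>x. f (x /\<^sub>R c)) \<longleftrightarrow> integrable lborel f"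
    and integral_lborel_scaleR: "(LINT x|lborel. f (x /\<^sub>R c)) = c ^ DIM('a) * (LINT x|lborel. f x)"
proof -
  have L: "lborel = density (distr lborel borel (\<lambda>x::'a. c *\<^sub>R x)) (\<lambda>_. ennreal (c ^ DIM('a)))"
    using lborel_affine[of c "0::'a"] c by simp
  show "integrable lborel (\<lambda>x. f (x /\<^sub>R c)) \<longleftrightarrow> integrable lborel f"
    using c by (subst L) (simp add: integrable_density integrable_distr_eq)
  show "(LINT x|lborel. f (x /\<^sub>R c)) = c ^ DIM('a) * (LINT x|lborel. f x)"
    using c by (subst L) (simp add: integral_density integral_distr)
qed

text \<open>The substitution x = \<rho>(u) y on each fibre, with Jacobian \<rho>(u)^d. It serves
  twice: with the square root for the ball moments, and with \<rho>(t) = t for the cone. Where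
  \<rho> is not positive, \<open>h\<close> is zero and the fibre contributes nothing.\<close>

lemma has_bochner_integral_scaled_product:
  fixes g :: "'a::euclidean_space \<Rightarrow> real" and h \<rho> :: "real \<Rightarrow> real"
  assumes g: "has_bochner_integral lborel g G"
    and h[measurable]: "h \<in> borel_measurable borel" and r[measurable]: "\<rho> \<in> borel_measurable borel"
    and pos: "\<And>u. h u \<noteq> 0 \<Longrightarrow> \<rho> u > 0"
    and hr: "has_bochner_integral lborel (\<lambda>u. h u * \<rho> u ^ DIM('a)) H"
  shows "has_bochner_integral lborel (\<lambda>z. g (fst z /\<^sub>R \<rho> (snd z)) * h (snd z)) (G * H)"
proof -
  have gi: "integrable lborel g" and gG: "integral\<^sup>L lborel g = G"
    using g by (auto simp: has_bochner_integral_iff)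
  have [measurable]: "g \<in> borel_measurable borel"
    using gi by (auto dest: borel_measurable_integrable)
  let ?F = "\<lambda>(u::real, x::'a). g (x /\<^sub>R \<rho> u) * h u"
  have int: "integrable lborel (\<lambda>x. ?F (u, x))" for u
  proof (cases "h u = 0")
    case False
    then show ?thesis using integrable_lborel_scaleR_iff[OF pos[OF False], of g] gi by simp
  qed simp
  have val: "(LINT x|lborel. ?F (u, x)) = G * (h u * \<rho> u ^ DIM('a))" for u
  proof (cases "h u = 0")
    case False
    then show ?thesis using integral_lborel_scaleR[OF pos[OF False], of g] gG by simp
  qed simp
  have nval: "(LINT x|lborel. norm (?F (u, x))) = (LINT x|lborel. \<bar>g x\<bar>) * norm (h u * \<rho> u ^ DIM('a))" for u
  proof (cases "h u = 0")
    case False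
    then show ?thesis using integral_lborel_scaleR[OF pos[OF False], of "\<lambda>x. \<bar>g x\<bar>"] pos[OF False]
      by (simp add: abs_mult)
  qed simp
  have F: "integrable (lborel \<Otimes>\<^sub>M lborel) ?F"
  proof (rule lborel_pair.Fubini_integrable)
    show "?F \<in> borel_measurable (lborel \<Otimes>\<^sub>M lborel)" by measurable
    show "integrable lborel (\<lambda>u. LINT x|lborel. norm (?F (u, x)))"
      unfolding nval using hr by (auto simp: has_bochner_integral_iff)
  qed (use int in simp)
  have "(LINT u|lborel. LINT x|lborel. ?F (u, x)) = integral\<^sup>L (lborel \<Otimes>\<^sub>M lborel) ?F"
    by (rule lborel_pair.integral_fst'[OF F])
  then have "has_bochner_integral (lborel \<Otimes>\<^sub>M lborel) ?F (G * H)"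
    using F hr unfolding val by (simp add: has_bochner_integral_iff)
  then have "has_bochner_integral (lborel \<Otimes>\<^sub>M lborel) (\<lambda>(x, u). ?F (u, x)) (G * H)"
    using lborel_pair.integral_product_swap[of ?F] lborel_pair.integrable_product_swap_iff[of ?F]
    by (auto simp: has_bochner_integral_iff)
  then show ?thesis
    by (simp add: lborel_prod case_prod_unfold)
qed

section \<open>Gamma integral and Gaussian moments\<close>

lemma has_bochner_integral_Gamma:
  assumes q: "(q::real) > 0"
  shows "has_bochner_integral lborel (\<lambda>t. if t > 0 then t powr (q - 1) * exp (- t) else 0) (Gamma q)"
proof (rule has_bochner_integral_nn_integral)
  have "(\<integral>\<^sup>+ t. ennreal (if t > 0 then t powr (q - 1) * exp (- t) else 0) \<partial>lborel) =
      (\<integral>\<^sup>+ t. ennreal (indicator {0..} t * t powr (q - 1) / exp t) \<partial>lborel)"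
    using AE_lborel_singleton[of "0::real"]
    by (intro nn_integral_cong_AE) (auto elim!: eventually_mono simp: exp_minus divide_inverse)
  then show "(\<integral>\<^sup>+ t. ennreal (if t > 0 then t powr (q - 1) * exp (- t) else 0) \<partial>lborel) = ennreal (Gamma q)"
    using Gamma_conv_nn_integral_real[OF q] by simp
qed (use q in \<open>auto intro: Gamma_real_pos less_imp_le\<close>)

definition gauss_moment :: "nat \<Rightarrow> real" where
  "gauss_moment m = (LINT x|lborel. exp (- x\<^sup>2) * x ^ m)"

lemma gauss_moment_even:
  "has_bochner_integral lborel (\<lambda>x::real. exp (- x\<^sup>2) * x ^ (2 * m)) (sqrt pi * (fact (2 * m) / (2 ^ (2 * m) * fact m)))"
  using has_bochner_integral_even_function[OF gaussian_moment_even_pos[of m]] by simp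

lemma gauss_moment_odd:
  "has_bochner_integral lborel (\<lambda>x::real. exp (- x\<^sup>2) * x ^ (2 * m + 1)) 0"
  using has_bochner_integral_odd_function[OF gaussian_moment_odd_pos[of m]] by simp

lemma has_bochner_integral_gauss_moment:
  "has_bochner_integral lborel (\<lambda>x. exp (- x\<^sup>2) * x ^ m) (gauss_moment m)"
proof (cases "even m")
  case True
  then show ?thesis using gauss_moment_even[of "m div 2"]
    by (auto simp: gauss_moment_def has_bochner_integral_iff)
next
  case False
  then show ?thesis using gauss_moment_odd[of "m div 2"]
    by (auto simp: gauss_moment_def has_bochner_integral_iff)
qed

lemma gauss_moment_eq_0: "odd m \<Longrightarrow> gauss_moment m = 0"
  using gauss_moment_odd[of "m div 2"] by (auto simp: gauss_moment_def has_bochner_integral_iff)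

text \<open>Integration by parts for exp(-x^2) x^m, checked on the explicit even moments; for even m
  the odd moments involved vanish. At m = 0 the truncated m - 1 is hidden by the factor m.\<close>

lemma gauss_moment_rec: "2 * gauss_moment (Suc m) = real m * gauss_moment (m - 1)"
proof (cases "even m")
  case True
  then show ?thesis by (cases "m = 0") (simp_all add: gauss_moment_eq_0)
next
  case False
  then obtain l where l: "m = 2 * l + 1" by (auto elim: oddE)
  have e: "gauss_moment (2 * j) = sqrt pi * (fact (2 * j) / (2 ^ (2 * j) * fact j))" for j
    using gauss_moment_even[of j] by (simp add: gauss_moment_def has_bochner_integral_iff)
  have "Suc m = 2 * Suc l" and "m - 1 = 2 * l" using l by auto
  then have m: "gauss_moment (Suc m) = sqrt pi * (fact (2 * Suc l) / (2 ^ (2 * Suc l) * fact (Suc l)))"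
    "gauss_moment (m - 1) = sqrt pi * (fact (2 * l) / (2 ^ (2 * l) * fact l))"
    by (simp_all only: e)
  show ?thesis
    unfolding m by (simp add: l divide_simps)
qed

lemma power2_norm_vec: "(norm (x :: real^'n))\<^sup>2 = (\<Sum>i\<in>UNIV. (x $ i)\<^sup>2)"
  unfolding power2_norm_eq_inner inner_vec_def by (simp add: power2_eq_square)

lemma has_bochner_integral_gauss_mpow:
  "has_bochner_integral lborel (\<lambda>x::real^'n. exp (- (norm x)\<^sup>2) * mpow x a) (\<Prod>i\<in>UNIV. gauss_moment (a i))"
  using has_bochner_integral_prod_vec[OF has_bochner_integral_gauss_moment, of a]
  by (simp add: power2_norm_vec mpow_def prod.distrib sum_negf[symmetric] exp_sum)

lemma mpow_scaleR: "mpow (c *\<^sub>R x) a = c ^ mdeg a * mpow x a"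
  by (simp add: mpow_def mdeg_def power_mult_distrib prod.distrib power_sum)

lemma continuous_mpow [continuous_intros]:
  "continuous_on A f \<Longrightarrow> continuous_on A (\<lambda>z. mpow (f z) a)"
  unfolding mpow_def by (intro continuous_intros)

lemma borel_measurable_mpow [measurable]: "(\<lambda>x. mpow x a) \<in> borel_measurable borel"
  by (intro borel_measurable_continuous_onI continuous_intros)

definition ball_fun :: "real \<Rightarrow> ('n::finite \<Rightarrow> nat) \<Rightarrow> real^'n \<Rightarrow> real" where
  "ball_fun s a y = (if norm y < 1 then (1 - (norm y)\<^sup>2) powr s * mpow y a else 0)"

text \<open>The Dirichlet integral of \<open>ball_fun s a\<close> in closed form. With the formula
  as definition, the recurrence is available before any integral over the ball is evaluated.\<close>

definition ball_moment :: "real \<Rightarrow> ('n::finite \<Rightarrow> nat) \<Rightarrow> real" where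
  "ball_moment s a = Gamma (s + 1) * (\<Prod>i\<in>UNIV. gauss_moment (a i))
     / Gamma (s + 1 + (real (mdeg a) + real CARD('n)) / 2)"

lemma ball_moment_eq_0: "odd (a i) \<Longrightarrow> ball_moment s a = 0"
  using gauss_moment_eq_0[of "a i"] by (auto simp: ball_moment_def)

lemma mdeg_upd_Suc: "mdeg (a(i := Suc (a i))) = Suc (mdeg a)"
proof -
  have "mdeg (a(i := m)) = m + (\<Sum>j\<in>UNIV - {i}. a j)" for m
    unfolding mdeg_def by (subst sum.remove[of _ i]) (auto intro: sum.cong)
  moreover have "mdeg a = a i + (\<Sum>j\<in>UNIV - {i}. a j)"
    unfolding mdeg_def by (subst sum.remove[of _ i]) auto
  ultimately show ?thesis by simp
qed

lemma prod_upd: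
  fixes a :: "'n::finite \<Rightarrow> nat" and f :: "nat \<Rightarrow> real"
  shows "(\<Prod>j\<in>UNIV. f ((a(i := m)) j)) = f m * (\<Prod>j\<in>UNIV - {i}. f (a j))"
  by (subst prod.remove[of _ i]) (auto intro: prod.cong)

text \<open>Integration by parts for \<open>\<partial>\<^sub>i ((1 - |y|\<^sup>2)\<^sup>s y\<^sup>a)\<close>, read off from the closed form.\<close>

lemma ball_moment_rec:
  fixes a :: "'n::finite \<Rightarrow> nat"
  assumes s: "s > 0"
  shows "real (a i) * ball_moment s (a(i := a i - 1)) = 2 * s * ball_moment (s - 1) (a(i := Suc (a i)))"
proof (cases "a i = 0")
  \<comment> \<open>The right-hand side has exponent 1 in coordinate \<open>i\<close>, so it is an
    odd moment.\<close>
  case True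
  then show ?thesis using ball_moment_eq_0[of "a(i := 1)" i] by simp
next
  case False
  define b where "b = a(i := a i - 1)"
  have a: "a = b(i := Suc (b i))" using False by (auto simp: b_def)
  have md: "mdeg a = Suc (mdeg b)" unfolding a by (rule mdeg_upd_Suc)
  have bi: "b i = a i - 1" by (simp add: b_def)
  define P Q where "P = (\<Prod>j\<in>UNIV. gauss_moment ((a(i := Suc (a i))) j))"
    and "Q = (\<Prod>j\<in>UNIV. gauss_moment (b j))"
  define D where "D = Gamma (s + 1 + (real (mdeg b) + real CARD('n)) / 2)"
  have PQ: "real (a i) * Q = 2 * P"
    unfolding P_def Q_def b_def prod_upd using gauss_moment_rec[of "a i"] by simp
  have G: "Gamma (s + 1) = s * Gamma s"
    using s by (intro Gamma_plus1) (auto elim!: nonpos_Ints_cases)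
  \<comment> \<open>Two more degrees in the monomial compensate for one less in the exponent, so
    both moments share the denominator \<open>D\<close>.\<close>
  have X: "s - 1 + 1 + (real (mdeg (a(i := Suc (a i)))) + real CARD('n)) / 2
      = s + 1 + (real (mdeg b) + real CARD('n)) / 2"
    by (simp add: mdeg_upd_Suc md)
  have M1: "ball_moment (s - 1) (a(i := Suc (a i))) = Gamma s * P / D"
    unfolding ball_moment_def P_def[symmetric] D_def X by simp
  have M2: "ball_moment s b = s * Gamma s * Q / D"
    unfolding ball_moment_def Q_def[symmetric] D_def[symmetric] G ..
  have "real (a i) * ball_moment s b = s * Gamma s * (real (a i) * Q) / D"
    unfolding M2 by simp
  then show ?thesis
    unfolding PQ M1 b_def by simp
qed

text \<open>
  The integral of \<open>(u - |x|\<^sup>2)\<^sup>s x\<^sup>a e\<^sup>-\<^sup>u\<close> over \<open>u > |x|\<^sup>2\<close> is evaluated in both orders: integrating over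
  \<open>u\<close> first leaves a Gaussian moment, substituting \<open>x = \<surd>u y\<close> leaves the moment of the ball.
\<close>

lemma has_bochner_integral_ball_fun:
  fixes a :: "'n::finite \<Rightarrow> nat"
  assumes s: "s > -1"
  shows "has_bochner_integral lborel (ball_fun s a) (ball_moment s a)"
proof -
  define F where "F x u = (if (norm x)\<^sup>2 < u then (u - (norm x)\<^sup>2) powr s * exp (- u) else 0) * mpow x a"
    for x :: "real^'n" and u :: real
  have Fm: "(\<lambda>(x, u). F x u) \<in> borel_measurable (lborel \<Otimes>\<^sub>M lborel)"
    unfolding F_def by measurable
  let ?E = "\<Prod>i\<in>UNIV. gauss_moment (a i)"
  have inner: "has_bochner_integral lborel
      (\<lambda>u. if r < u then (u - r) powr s * exp (- u) else 0) (exp (- r) * Gamma (s + 1))" for r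
  proof -
    have "has_bochner_integral lborel (\<lambda>t. if t > 0 then t powr s * exp (- t) else 0) (Gamma (s + 1))"
      using has_bochner_integral_Gamma[of "s + 1"] s unfolding add_diff_cancel_right' by simp
    then have "has_bochner_integral lborel
        (\<lambda>u. if 0 < - r + 1 * u then (- r + 1 * u) powr s * exp (- (- r + 1 * u)) else 0) (Gamma (s + 1) /\<^sub>R \<bar>1\<bar>)"
      by (subst (asm) lborel_has_bochner_integral_real_affine_iff[where c = 1 and t = "- r"]) simp_all
    then have "has_bochner_integral lborel (\<lambda>u. exp (- r) *
        (if 0 < - r + 1 * u then (- r + 1 * u) powr s * exp (- (- r + 1 * u)) else 0)) (exp (- r) * (Gamma (s + 1) /\<^sub>R \<bar>1\<bar>))"
      by (rule has_bochner_integral_mult_right)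
    also have "(\<lambda>u. exp (- r) * (if 0 < - r + 1 * u then (- r + 1 * u) powr s * exp (- (- r + 1 * u)) else 0))
        = (\<lambda>u. if r < u then (u - r) powr s * exp (- u) else 0)"
      by (auto simp: fun_eq_iff mult_exp_exp algebra_simps)
    finally show ?thesis by simp
  qed
  have Fu: "has_bochner_integral lborel (F x) (exp (- (norm x)\<^sup>2) * Gamma (s + 1) * mpow x a)" for x
    unfolding F_def by (intro has_bochner_integral_mult_left inner)
  have nFu: "(LINT u|lborel. norm (F x u)) = norm (exp (- (norm x)\<^sup>2) * mpow x a) * Gamma (s + 1)" for x
  proof -
    have "norm (F x u) = (if (norm x)\<^sup>2 < u then (u - (norm x)\<^sup>2) powr s * exp (- u) else 0) * \<bar>mpow x a\<bar>" for u
      by (simp add: F_def abs_mult)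
    then show ?thesis
      using inner[of "(norm x)\<^sup>2"] by (simp add: has_bochner_integral_iff abs_mult)
  qed
  have Fint: "integrable (lborel \<Otimes>\<^sub>M lborel) (\<lambda>(x, u). F x u)"
  proof (rule lborel_pair.Fubini_integrable[OF Fm])
    show "integrable lborel (\<lambda>x. LINT u|lborel. norm (case (x, u) of (x, u) \<Rightarrow> F x u))"
      using has_bochner_integral_gauss_mpow[of a] unfolding split nFu
      by (intro integrable_mult_left integrable_norm) (simp add: has_bochner_integral_iff)
    show "AE x in lborel. integrable lborel (\<lambda>u. case (x, u) of (x, u) \<Rightarrow> F x u)"
      using Fu by (simp add: has_bochner_integral_iff)
  qed
  have Fval: "integral\<^sup>L (lborel \<Otimes>\<^sub>M lborel) (\<lambda>(x, u). F x u) = Gamma (s + 1) * ?E"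
  proof -
    have "(LINT u|lborel. F x u) = Gamma (s + 1) * (exp (- (norm x)\<^sup>2) * mpow x a)" for x
      using Fu[of x] by (simp add: has_bochner_integral_iff)
    then show ?thesis
      using lborel_pair.integral_fst[OF Fint] has_bochner_integral_gauss_mpow[of a]
      by (simp add: has_bochner_integral_iff)
  qed
  define h where "h u = (if u > 0 then u powr (s + real (mdeg a) / 2) * exp (- u) else 0)" for u :: real
  have hm: "h \<in> borel_measurable borel"
  proof -
    have "(\<lambda>u. if u > 0 then u powr c * exp (- u) else 0) \<in> borel_measurable borel" for c :: real
      by measurable
    then show ?thesis unfolding h_def by blast
  qed
  \<comment> \<open>With y = x / sqrt u one has u - |x|^2 = u (1 - |y|^2) and x^a = u^(|a|/2) y^a,
    which fixes the exponent in \<open>h\<close>.\<close>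
  have Fh: "F x u = ball_fun s a (x /\<^sub>R sqrt u) * h u" for x u
  proof (cases "u > 0")
    case False
    then have "\<not> (norm x)\<^sup>2 < u" using zero_le_power2[of "norm x"] by linarith
    then show ?thesis unfolding F_def h_def if_not_P[OF False] by simp
  next
    case True
    have n: "norm (x /\<^sub>R sqrt u) < 1 \<longleftrightarrow> (norm x)\<^sup>2 < u"
    proof -
      have "norm (x /\<^sub>R sqrt u) < 1 \<longleftrightarrow> norm x < sqrt u"
        using True by (simp add: divide_simps)
      also have "\<dots> \<longleftrightarrow> (norm x)\<^sup>2 < u"
        using real_sqrt_less_iff[of "(norm x)\<^sup>2" u] by simp
      finally show ?thesis .
    qed
    have n2: "(norm (x /\<^sub>R sqrt u))\<^sup>2 = (norm x)\<^sup>2 / u"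
      using True by (simp add: power_mult_distrib field_simps)
    show ?thesis
    proof (cases "(norm x)\<^sup>2 < u")
      case False
      with n show ?thesis by (simp add: F_def ball_fun_def)
    next
      case lt: True
      have e1: "u - (norm x)\<^sup>2 = u * (1 - (norm x)\<^sup>2 / u)" using True by (simp add: field_simps)
      have "1 - (norm x)\<^sup>2 / u > 0" using lt True by simp
      then have e2: "(u - (norm x)\<^sup>2) powr s = u powr s * (1 - (norm x)\<^sup>2 / u) powr s"
        using True unfolding e1 by (simp add: powr_mult)
      have e3: "mpow x a = sqrt u ^ mdeg a * mpow (x /\<^sub>R sqrt u) a"
        using True by (simp add: mpow_scaleR field_simps)
      have e4: "sqrt u ^ mdeg a = u powr (real (mdeg a) / 2)"
        using True by (simp add: powr_half_sqrt[symmetric] powr_realpow[symmetric] powr_powr)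
      show ?thesis
        using lt n True n2 by (simp add: F_def h_def ball_fun_def e2 e3 e4 powr_add mult_ac)
    qed
  qed
  \<comment> \<open>Integrability on the ball is inherited from Fubini: almost every section of
    \<open>F\<close> in \<open>u\<close> is integrable, (0, 1) is not a null set, and a section with
    u > 0 is a rescaled \<open>ball_fun\<close> times a nonzero constant.\<close>
  have ball_int: "integrable lborel (ball_fun s a)"
  proof -
    have "AE u in lborel. integrable lborel (\<lambda>x. F x u)"
      by (rule lborel_pair.AE_integrable_snd[OF Fint])
    moreover have "\<not> (AE u in lborel. u \<notin> {0<..<1::real})"
      using AE_iff_null_sets[of "{0<..<1::real}" lborel] by (auto simp: null_sets_def)
    ultimately obtain u :: real where u: "u \<in> {0<..<1}" "integrable lborel (\<lambda>x. F x u)"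
      by (metis (mono_tags, lifting) eventually_mono)
    then have "h u \<noteq> 0" by (simp add: h_def)
    with u have "integrable lborel (\<lambda>x. ball_fun s a (x /\<^sub>R sqrt u))"
      by (simp add: Fh)
    moreover have "ball_fun s a \<in> borel_measurable borel"
      unfolding ball_fun_def by measurable
    ultimately show ?thesis
      using integrable_lborel_scaleR_iff[of "sqrt u" "ball_fun s a"] u by simp
  qed
  have hr: "has_bochner_integral lborel (\<lambda>u. h u * sqrt u ^ DIM(real^'n))
      (Gamma (s + 1 + (real (mdeg a) + real CARD('n)) / 2))"
  proof -
    have "(\<lambda>u. h u * sqrt u ^ DIM(real^'n)) =
        (\<lambda>u. if u > 0 then u powr ((s + 1 + (real (mdeg a) + real CARD('n)) / 2) - 1) * exp (- u) else 0)"
    proof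
      fix u :: real
      show "h u * sqrt u ^ DIM(real^'n) = (if u > 0 then u powr ((s + 1 + (real (mdeg a) + real CARD('n)) / 2) - 1) * exp (- u) else 0)"
      proof (cases "u > 0")
        case True
        then have "sqrt u ^ DIM(real^'n) = u powr (real CARD('n) / 2)"
          by (simp add: powr_half_sqrt[symmetric] powr_realpow[symmetric] powr_powr)
        then show ?thesis using True
          by (simp add: h_def powr_add[symmetric] add_divide_distrib add.assoc)
      qed (simp add: h_def)
    qed
    moreover have "s + 1 + (real (mdeg a) + real CARD('n)) / 2 > 0"
      using s by (simp add: add_pos_nonneg)
    ultimately show ?thesis
      using has_bochner_integral_Gamma[of "s + 1 + (real (mdeg a) + real CARD('n)) / 2"] by (simp only:)
  qed
  have "has_bochner_integral lborel (\<lambda>z. ball_fun s a (fst z /\<^sub>R sqrt (snd z)) * h (snd z))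
      (integral\<^sup>L lborel (ball_fun s a) * Gamma (s + 1 + (real (mdeg a) + real CARD('n)) / 2))"
    by (rule has_bochner_integral_scaled_product[OF has_bochner_integral_integrable[OF ball_int] hm _ _ hr])
       (auto simp: h_def split: if_splits)
  then have "Gamma (s + 1) * ?E =
      integral\<^sup>L lborel (ball_fun s a) * Gamma (s + 1 + (real (mdeg a) + real CARD('n)) / 2)"
    using Fval by (simp add: lborel_prod case_prod_unfold Fh[symmetric] has_bochner_integral_iff)
  moreover have "Gamma (s + 1 + (real (mdeg a) + real CARD('n)) / 2) > 0"
    using s by (intro Gamma_real_pos) (simp add: add_pos_nonneg)
  ultimately show ?thesis
    using ball_int by (simp add: has_bochner_integral_iff ball_moment_def field_simps)
qed

section \<open>Derivatives of powers of \<open>t\<^sup>2 - |x|\<^sup>2\<close>\<close>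

text \<open>A triple \<open>(c, e, a)\<close> in such a list encodes the term \<open>c (t\<^sup>2 - |x|\<^sup>2)\<^sup>p\<^sup>-\<^sup>e x\<^sup>a\<close>.\<close>

type_synonym 'n radial = "(real \<times> nat \<times> ('n \<Rightarrow> nat)) list"

definition radial_eval :: "real \<Rightarrow> real \<Rightarrow> 'n::finite radial \<Rightarrow> real^'n \<Rightarrow> real" where
  "radial_eval p t L x = (\<Sum>(c, e, a)\<leftarrow>L. c * (t\<^sup>2 - (norm x)\<^sup>2) powr (p - real e) * mpow x a)"

text \<open>The entry with lowered exponent is omitted when a i = 0: its coefficient would be zero,
  but truncated subtraction would leave the degree of \<open>a\<close> unchanged and spoil
  \<open>radial_homogeneous\<close>.\<close>

definition radial_deriv1 :: "real \<Rightarrow> 'n \<Rightarrow> real \<times> nat \<times> ('n \<Rightarrow> nat) \<Rightarrow> 'n radial" where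
  "radial_deriv1 p i = (\<lambda>(c, e, a). (if a i = 0 then [] else [(c * real (a i), e, a(i := a i - 1))])
     @ [(- 2 * (p - real e) * c, Suc e, a(i := Suc (a i)))])"

definition radial_deriv :: "real \<Rightarrow> 'n \<Rightarrow> 'n radial \<Rightarrow> 'n radial" where
  "radial_deriv p i L = concat (map (radial_deriv1 p i) L)"

text \<open>
  The equation fixes the degree \<open>2 p - m\<close> of each term; \<open>e \<le> m\<close> keeps the exponents \<open>p - e\<close> in
  the range where the moments exist.
\<close>

definition radial_homogeneous :: "nat \<Rightarrow> 'n::finite radial \<Rightarrow> bool" where
  "radial_homogeneous m L \<longleftrightarrow> (\<forall>(c, e, a)\<in>set L. e \<le> m \<and> 2 * e = mdeg a + m)"

text \<open>This is to be the integral of \<open>radial_eval p 1 L\<close> times y^b over the unit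
  ball, see \<open>has_bochner_integral_radial_eval\<close>. As a finite sum of closed forms it can
  be manipulated without questions of convergence.\<close>

definition radial_moment :: "real \<Rightarrow> 'n::finite radial \<Rightarrow> ('n \<Rightarrow> nat) \<Rightarrow> real" where
  "radial_moment p L b = (\<Sum>(c, e, a)\<leftarrow>L. c * ball_moment (p - real e) (\<lambda>i. a i + b i))"

lemma radial_eval_simps [simp]:
  "radial_eval p t [] x = 0"
  "radial_eval p t ((c, e, a) # L) x = c * (t\<^sup>2 - (norm x)\<^sup>2) powr (p - real e) * mpow x a + radial_eval p t L x"
  "radial_eval p t (L @ L') x = radial_eval p t L x + radial_eval p t L' x"
  by (simp_all add: radial_eval_def)

lemma radial_moment_simps [simp]:
  "radial_moment p [] b = 0"
  "radial_moment p ((c, e, a) # L) b = c * ball_moment (p - real e) (\<lambda>i. a i + b i) + radial_moment p L b"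
  "radial_moment p (L @ L') b = radial_moment p L b + radial_moment p L' b"
  by (simp_all add: radial_moment_def)

lemma radial_deriv_simps [simp]:
  "radial_deriv p i [] = []"
  "radial_deriv p i (z # L) = radial_deriv1 p i z @ radial_deriv p i L"
  by (simp_all add: radial_deriv_def)

lemma radial_homogeneous_simps [simp]:
  "radial_homogeneous m []"
  "radial_homogeneous m ((c, e, a) # L) \<longleftrightarrow> e \<le> m \<and> 2 * e = mdeg a + m \<and> radial_homogeneous m L"
  "radial_homogeneous m (L @ L') \<longleftrightarrow> radial_homogeneous m L \<and> radial_homogeneous m L'"
  by (auto simp: radial_homogeneous_def ball_Un)

lemma mpow_upd: "mpow x (a(i := m)) = (x $ i) ^ m * (\<Prod>j\<in>UNIV - {i}. (x $ j) ^ a j)"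
  unfolding mpow_def by (subst prod.remove[of _ i]) (auto intro: prod.cong)

lemma mdeg_upd_pred:
  assumes "a i \<noteq> 0"
  shows "mdeg a = Suc (mdeg (a(i := a i - 1)))"
  using mdeg_upd_Suc[of "a(i := a i - 1)" i] assms by simp

lemma radial_homogeneous_deriv:
  "radial_homogeneous m L \<Longrightarrow> radial_homogeneous (Suc m) (radial_deriv p i L)"
proof (induction L)
  case (Cons z L)
  obtain c e a where z: "z = (c, e, a)" by (metis prod.collapse)
  have "a i \<noteq> 0 \<Longrightarrow> mdeg a = Suc (mdeg (a(i := a i - 1)))" by (rule mdeg_upd_pred)
  then show ?case
    using Cons by (auto simp: z radial_deriv1_def mdeg_upd_Suc)
qed simp

lemma radial_eval_has_derivative:
  fixes x :: "real^'n"
  assumes x: "norm x < t"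
  shows "((\<lambda>h. radial_eval p t L (x + h *\<^sub>R axis i 1)) has_field_derivative
    radial_eval p t (radial_deriv p i L) x) (at 0)"
proof (induction L)
  case (Cons z L)
  obtain c e a where z: "z = (c, e, a)" by (metis prod.collapse)
  define R where "R = (\<Prod>j\<in>UNIV - {i}. (x $ j) ^ a j)"
  define B where "B = t\<^sup>2 - (norm x)\<^sup>2"
  have B: "B > 0" unfolding B_def using x by (simp add: power_strict_mono)
  have n: "t\<^sup>2 - (norm (x + h *\<^sub>R axis i 1))\<^sup>2 = B - 2 * h * x $ i - h\<^sup>2" for h
    unfolding B_def power2_norm_eq_inner
    by (simp add: inner_add_left inner_add_right inner_axis inner_axis' algebra_simps power2_eq_square)
  have m: "mpow (x + h *\<^sub>R axis i 1) a = (x $ i + h) ^ a i * R" for h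
    using mpow_upd[of "x + h *\<^sub>R axis i 1" a i "a i"]
    by (simp add: R_def axis_def cong: prod.cong_simp)
  have m': "mpow x (a(i := l)) = (x $ i) ^ l * R" for l
    unfolding R_def by (rule mpow_upd)
  have "((\<lambda>h. c * (B - 2 * h * x $ i - h\<^sup>2) powr (p - real e) * ((x $ i + h) ^ a i * R)) has_field_derivative
      c * ((p - real e) * B powr (p - real e - 1) * (- 2 * x $ i)) * ((x $ i) ^ a i * R)
      + c * B powr (p - real e) * (real (a i) * (x $ i) ^ (a i - 1) * R)) (at 0)"
    using B by (auto intro!: derivative_eq_intros simp: field_simps)
  also have "c * ((p - real e) * B powr (p - real e - 1) * (- 2 * x $ i)) * ((x $ i) ^ a i * R)
      + c * B powr (p - real e) * (real (a i) * (x $ i) ^ (a i - 1) * R)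
      = radial_eval p t (radial_deriv1 p i z) x"
    by (simp add: z radial_deriv1_def m' B_def[symmetric] algebra_simps)
  finally show ?case
    using Cons unfolding z radial_eval_simps radial_deriv_simps n m by (intro DERIV_add)
qed simp

text \<open>Agreement is assumed only for |x| < t, where the base of the power is positive. That set
  is open, so the conclusion holds on it again and the lemma can be iterated.\<close>

lemma partial_deriv_radial:
  fixes f :: "real^'n \<Rightarrow> real"
  assumes f: "\<And>x. norm x < t \<Longrightarrow> f x = radial_eval p t L x" and x: "norm x < t"
  shows "partial_deriv i f x = radial_eval p t (radial_deriv p i L) x"
proof -
  have "((\<lambda>h. norm (x + h *\<^sub>R axis i 1)) \<longlongrightarrow> norm (x + 0 *\<^sub>R axis i 1)) (nhds 0)"
    by (intro tendsto_intros filterlim_ident)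
  then have "eventually (\<lambda>h. norm (x + h *\<^sub>R axis i 1) < t) (nhds 0)"
    by (rule order_tendstoD) (use x in simp)
  then have "eventually (\<lambda>h. f (x + h *\<^sub>R axis i 1) = radial_eval p t L (x + h *\<^sub>R axis i 1)) (nhds 0)"
    by eventually_elim (rule f)
  then show ?thesis
    unfolding partial_deriv_def
    by (subst deriv_cong_ev[OF _ refl]) (auto intro: DERIV_imp_deriv radial_eval_has_derivative x)
qed

lemma funpow_partial_deriv_radial:
  fixes f :: "real^'n \<Rightarrow> real"
  assumes "\<And>x. norm x < t \<Longrightarrow> f x = radial_eval p t L x" "norm x < t"
  shows "(partial_deriv i ^^ m) f x = radial_eval p t ((radial_deriv p i ^^ m) L) x"
  using assms(2)
proof (induction m arbitrary: x)
  case (Suc m)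
  then show ?case by (simp add: partial_deriv_radial)
qed (simp add: assms(1))

lemma foldr_partial_deriv_radial:
  fixes f :: "real^'n \<Rightarrow> real"
  assumes "\<And>x. norm x < t \<Longrightarrow> f x = radial_eval p t L x" "norm x < t"
  shows "foldr (\<lambda>i. partial_deriv i ^^ k i) xs f x = radial_eval p t (foldr (\<lambda>i. radial_deriv p i ^^ k i) xs L) x"
  using assms(2)
proof (induction xs arbitrary: x)
  case (Cons i xs)
  then show ?case by (simp add: funpow_partial_deriv_radial)
qed (simp add: assms(1))

lemma radial_homogeneous_funpow:
  "radial_homogeneous m L \<Longrightarrow> radial_homogeneous (m + l) ((radial_deriv p i ^^ l) L)"
  by (induction l) (auto intro: radial_homogeneous_deriv)

lemma radial_homogeneous_foldr:
  "radial_homogeneous m L \<Longrightarrow>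
    radial_homogeneous (m + sum_list (map k xs)) (foldr (\<lambda>i. radial_deriv p i ^^ k i) xs L)"
proof (induction xs)
  case (Cons i xs)
  then have "radial_homogeneous (m + sum_list (map k xs) + k i) (foldr (\<lambda>i. radial_deriv p i ^^ k i) (i # xs) L)"
    by (auto intro: radial_homogeneous_funpow)
  then show ?case by (simp add: add_ac)
qed simp

text \<open>Integration by parts against y^b without boundary term. With A = a + b, differentiating
  the monomial contributes a_i, and differentiating the power contributes -A_i, times the same
  moment by \<open>ball_moment_rec\<close>; together this is -b_i. The bound on \<open>p\<close>
  makes every p - e positive, as the recurrence requires.\<close>

lemma radial_moment_deriv:
  fixes b :: "'n::finite \<Rightarrow> nat"
  assumes "radial_homogeneous m L" and p: "p > real m"
  shows "radial_moment p (radial_deriv p i L) b = - real (b i) * radial_moment p L (b(i := b i - 1))"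
  using assms(1)
proof (induction L)
  case (Cons z L)
  obtain c e a where z: "z = (c, e, a)" by (metis prod.collapse)
  define A where "A = (\<lambda>j. a j + b j)"
  have pe: "p - real e > 0" using Cons.prems p by (auto simp: z)
  have rec: "real (A i) * ball_moment (p - real e) (A(i := A i - 1)) =
      2 * (p - real e) * ball_moment (p - real (Suc e)) (A(i := Suc (A i)))"
    using ball_moment_rec[OF pe, of A i] by (simp add: algebra_simps)
  have s1: "(\<lambda>j. (a(i := Suc (a i))) j + b j) = A(i := Suc (A i))"
    by (auto simp: A_def)
  have s2: "(\<lambda>j. (a(i := a i - 1)) j + b j) = A(i := A i - 1)" if "a i \<noteq> 0"
    using that by (auto simp: A_def)
  have s3: "(\<lambda>j. a j + (b(i := b i - 1)) j) = A(i := A i - 1)" if "b i \<noteq> 0"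
    using that by (auto simp: A_def)
  define M where "M = ball_moment (p - real e) (A(i := A i - 1))"
  have t1: "radial_moment p (radial_deriv1 p i z) b = c * real (a i) * M - c * (real (A i) * M)"
  proof -
    have "- 2 * (p - real e) * c * ball_moment (p - real (Suc e)) (A(i := Suc (A i))) = - c * (real (A i) * M)"
      unfolding M_def rec by (simp add: algebra_simps del: of_nat_Suc)
    moreover have "radial_moment p (radial_deriv1 p i z) b = c * real (a i) * M
       + - 2 * (p - real e) * c * ball_moment (p - real (Suc e)) (A(i := Suc (A i)))"
    proof (cases "a i = 0")
      case True
      show ?thesis
        unfolding z radial_deriv1_def split if_P[OF True] append_Nil radial_moment_simps s1 by (simp add: True)
    next
      case False
      show ?thesis
        unfolding z radial_deriv1_def M_def split if_not_P[OF False] append_Nil append_Cons radial_moment_simps s1 s2[OF False]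
        by simp
    qed
    ultimately show ?thesis by simp
  qed
  \<comment> \<open>For b i = 0 the two multi-indices may differ, but then the factor b i is
    zero.\<close>
  have "real (b i) * (c * ball_moment (p - real e) (\<lambda>j. a j + (b(i := b i - 1)) j)) = real (b i) * (c * M)"
    using s3 by (cases "b i = 0") (simp_all add: M_def)
  moreover have "c * real (a i) * M - c * (real (A i) * M) = - (real (b i) * (c * M))"
    by (simp add: A_def algebra_simps)
  moreover have "radial_moment p (radial_deriv p i L) b = - real (b i) * radial_moment p L (b(i := b i - 1))"
    using Cons.IH Cons.prems by (simp add: z del: fun_upd_apply)
  ultimately show ?case
    unfolding z radial_deriv_simps radial_moment_simps t1[unfolded z]
    by (auto simp: distrib_left simp del: fun_upd_apply)
qed simp

text \<open>The factors b_i, b_i - 1, ... multiply to l! times a binomial coefficient, which is zero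
  once l exceeds b_i, so truncation in b i - l does no harm. The last derivative acts on a list of
  level m + l - 1, whence the bound p + 1 > m + l.\<close>

lemma radial_moment_funpow:
  fixes b :: "'n::finite \<Rightarrow> nat"
  assumes "radial_homogeneous m L" and "p + 1 > real (m + l)"
  shows "radial_moment p ((radial_deriv p i ^^ l) L) b
    = (- 1) ^ l * fact l * real (b i choose l) * radial_moment p L (b(i := b i - l))"
  using assms(2)
proof (induction l arbitrary: b)
  case (Suc l)
  have "radial_moment p ((radial_deriv p i ^^ Suc l) L) b
      = - real (b i) * radial_moment p ((radial_deriv p i ^^ l) L) (b(i := b i - 1))"
    using radial_moment_deriv[OF radial_homogeneous_funpow[OF assms(1), of l p i], of p i b] Suc.prems by simp
  also have "\<dots> = (- 1) ^ Suc l * (real (b i) * fact l * real (b i - 1 choose l)) * radial_moment p L (b(i := b i - Suc l))"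
    using Suc.IH[of "b(i := b i - 1)"] Suc.prems by (simp del: fun_upd_apply add: fun_upd_same)
  also have "real (b i) * fact l * real (b i - 1 choose l) = fact (Suc l) * real (b i choose Suc l)"
  proof (cases "b i")
    case (Suc q)
    have "real (Suc q * (q choose l)) = real ((Suc q choose Suc l) * Suc l)"
      by (simp only: Suc_times_binomial_eq)
    then show ?thesis by (simp add: Suc algebra_simps)
  qed simp
  finally show ?case by (simp add: mult_ac)
qed simp

text \<open>As \<open>xs\<close> is distinct, lowering the exponent in one coordinate leaves the
  factors of the others unchanged.\<close>

lemma radial_moment_foldr:
  fixes b k :: "'n::finite \<Rightarrow> nat"
  assumes "radial_homogeneous m L" and "distinct xs" and "p + 1 > real (m + sum_list (map k xs))"
  shows "radial_moment p (foldr (\<lambda>i. radial_deriv p i ^^ k i) xs L) b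
    = (\<Prod>i\<in>set xs. (- 1) ^ k i * fact (k i) * real (b i choose k i))
      * radial_moment p L (\<lambda>i. if i \<in> set xs then b i - k i else b i)"
  using assms(2,3)
proof (induction xs arbitrary: b)
  case (Cons i xs)
  let ?L = "foldr (\<lambda>i. radial_deriv p i ^^ k i) xs L"
  have i: "i \<notin> set xs" using Cons.prems by simp
  have "radial_moment p (foldr (\<lambda>i. radial_deriv p i ^^ k i) (i # xs) L) b
     = (- 1) ^ k i * fact (k i) * real (b i choose k i) * radial_moment p ?L (b(i := b i - k i))"
    using radial_moment_funpow[OF radial_homogeneous_foldr[OF assms(1), of k xs p], of "k i" p i b] Cons.prems
    by (simp add: add_ac)
  also have "radial_moment p ?L (b(i := b i - k i)) =
     (\<Prod>j\<in>set xs. (- 1) ^ k j * fact (k j) * real (b j choose k j))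
      * radial_moment p L (\<lambda>j. if j \<in> set xs then (b(i := b i - k i)) j - k j else (b(i := b i - k i)) j)"
  proof -
    have "(\<Prod>j\<in>set xs. (- 1) ^ k j * fact (k j) * real ((b(i := b i - k i)) j choose k j))
        = (\<Prod>j\<in>set xs. (- 1) ^ k j * fact (k j) * real (b j choose k j))"
      using i by (intro prod.cong) auto
    then show ?thesis
      using Cons.IH[of "b(i := b i - k i)"] Cons.prems by (simp del: fun_upd_apply)
  qed
  also have "(\<lambda>j. if j \<in> set xs then (b(i := b i - k i)) j - k j else (b(i := b i - k i)) j)
     = (\<lambda>j. if j \<in> set (i # xs) then b j - k j else b j)"
    using i by auto
  finally show ?case using i by (simp add: mult_ac)
qed simp

section \<open>Derivatives of multi-index order\<close>

lemma coords_distinct: "distinct (coords :: 'n::finite list)" and set_coords: "set (coords :: 'n::finite list) = UNIV"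
proof -
  have "\<exists>xs :: 'n list. distinct xs \<and> set xs = UNIV"
    using finite_distinct_list[of "UNIV :: 'n set"] by auto
  then have "distinct (coords :: 'n list) \<and> set (coords :: 'n list) = UNIV"
    unfolding coords_def by (rule someI_ex)
  then show "distinct (coords :: 'n list)" and "set (coords :: 'n list) = UNIV" by auto
qed

lemma sum_list_coords: "sum_list (map k coords) = mdeg k"
  using sum_list_distinct_conv_sum_set[OF coords_distinct, of k] by (simp add: mdeg_def set_coords)

text \<open>The initial list encodes (t^2 - |x|^2)^p. The result does not depend on t, so the same
  list describes the derivative at every height and on the unit ball.\<close>

definition rodrigues_radial :: "real \<Rightarrow> ('n::finite \<Rightarrow> nat) \<Rightarrow> 'n radial" where
  "rodrigues_radial p k = foldr (\<lambda>i. radial_deriv p i ^^ k i) coords [(1, 0, \<lambda>_. 0)]"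

lemma multi_deriv_radial:
  "norm x < t \<Longrightarrow> multi_deriv k (\<lambda>y. (t\<^sup>2 - (norm y)\<^sup>2) powr p) x = radial_eval p t (rodrigues_radial p k) x"
  unfolding multi_deriv_def rodrigues_radial_def
  by (rule foldr_partial_deriv_radial) (simp_all add: mpow_def)

lemma radial_homogeneous_rodrigues: "radial_homogeneous (mdeg k) (rodrigues_radial p k)"
  using radial_homogeneous_foldr[of 0 "[(1, 0, \<lambda>_. 0)]" k coords p]
  by (simp add: rodrigues_radial_def sum_list_coords) (simp add: mdeg_def)

lemma radial_moment_rodrigues:
  assumes "p + 1 > real (mdeg k)"
  shows "radial_moment p (rodrigues_radial p k) b
    = (- 1) ^ mdeg k * real (mfact k) * (\<Prod>i\<in>UNIV. real (b i choose k i)) * ball_moment p (\<lambda>i. b i - k i)"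
proof -
  have "radial_homogeneous 0 [(1, 0, \<lambda>_::'a. 0)]" by (simp add: mdeg_def)
  then show ?thesis
    unfolding rodrigues_radial_def using radial_moment_foldr[OF _ coords_distinct, of 0 _ k p b] assms
    by (simp add: sum_list_coords set_coords prod.distrib mfact_def mdeg_def power_sum)
qed

text \<open>Under joint scaling of x and t a term (c, e, a) has degree 2 (p - e) + |a|, and
  homogeneity makes this 2 p - m for all terms.\<close>

lemma radial_eval_scale:
  assumes "radial_homogeneous m L" and x: "norm x < t"
  shows "radial_eval p t L x = t powr (2 * p - real m) * radial_eval p 1 L (x /\<^sub>R t)"
  using assms(1)
proof (induction L)
  case (Cons z L)
  obtain c e a where z: "z = (c, e, a)" by (metis prod.collapse)
  have t: "t > 0" using x norm_ge_zero[of x] by linarith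
  have "2 * e = mdeg a + m" using Cons.prems by (simp add: z)
  then have "real (2 * e) = real (mdeg a + m)" by (rule arg_cong)
  then have e: "2 * real e = real (mdeg a) + real m" by simp
  define y where "y = x /\<^sub>R t"
  have xy: "x = t *\<^sub>R y" using t by (simp add: y_def)
  have "norm x = t * norm y" using t by (simp add: xy)
  then have "norm y < 1" using x t by simp
  then have p: "1 - (norm y)\<^sup>2 > 0" by (simp add: power_less_one_iff)
  have "t\<^sup>2 - (norm x)\<^sup>2 = t\<^sup>2 * (1 - (norm y)\<^sup>2)"
    by (simp add: xy power_mult_distrib algebra_simps)
  then have 1: "(t\<^sup>2 - (norm x)\<^sup>2) powr (p - real e) = (t\<^sup>2) powr (p - real e) * (1 - (norm y)\<^sup>2) powr (p - real e)"
    using p t by (simp add: powr_mult)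
  have 2: "(t\<^sup>2) powr (p - real e) = t powr (2 * p - 2 * real e)"
  proof -
    have "t\<^sup>2 = t powr 2" using t by simp
    then show ?thesis by (simp only: powr_powr) (simp add: algebra_simps)
  qed
  have 3: "mpow x a = t powr real (mdeg a) * mpow y a"
    using t by (simp add: xy mpow_scaleR powr_realpow)
  have "2 * p - real m = 2 * p - 2 * real e + real (mdeg a)" using e by simp
  then have 4: "t powr (2 * p - real m) = t powr (2 * p - 2 * real e) * t powr real (mdeg a)"
    by (simp only: powr_add)
  have "c * (t\<^sup>2 - (norm x)\<^sup>2) powr (p - real e) * mpow x a
     = t powr (2 * p - real m) * (c * (1\<^sup>2 - (norm y)\<^sup>2) powr (p - real e) * mpow y a)"
    unfolding 1 2 3 4 by simp
  moreover have "radial_eval p t L x = t powr (2 * p - real m) * radial_eval p 1 L y"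
    using Cons by (simp add: z y_def)
  ultimately show ?case
    unfolding z radial_eval_simps y_def[symmetric] by (simp only: distrib_left)
qed simp

lemma mpow_add: "mpow x (\<lambda>i. a i + b i) = mpow x a * mpow x b"
  by (simp add: mpow_def power_add prod.distrib)

lemma has_bochner_integral_radial_eval:
  assumes "radial_homogeneous m L" and p: "p + 1 > real m"
  shows "has_bochner_integral lborel (\<lambda>y. if norm y < 1 then radial_eval p 1 L y * mpow y b else 0) (radial_moment p L b)"
  using assms(1)
proof (induction L)
  case Nil
  then show ?case by (simp add: has_bochner_integral_zero cong: if_cong)
next
  case (Cons z L)
  obtain c e a where z: "z = (c, e, a)" by (metis prod.collapse)
  \<comment> \<open>The clause e \<le> m of homogeneity keeps the exponent above -1, where the
    integral converges at the sphere.\<close>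
  have "p - real e > - 1" using Cons.prems p by (simp add: z)
  then have "has_bochner_integral lborel
     (\<lambda>y. c * ball_fun (p - real e) (\<lambda>i. a i + b i) y + (if norm y < 1 then radial_eval p 1 L y * mpow y b else 0))
     (c * ball_moment (p - real e) (\<lambda>i. a i + b i) + radial_moment p L b)"
    using Cons by (intro has_bochner_integral_add has_bochner_integral_mult_right has_bochner_integral_ball_fun) (auto simp: z)
  also have "(\<lambda>y. c * ball_fun (p - real e) (\<lambda>i. a i + b i) y + (if norm y < 1 then radial_eval p 1 L y * mpow y b else 0))
      = (\<lambda>y. if norm y < 1 then radial_eval p 1 (z # L) y * mpow y b else 0)"
    by (auto simp: fun_eq_iff z ball_fun_def mpow_add algebra_simps)
  finally show ?case by (simp add: z)
qed

section \<open>Derivatives of \<open>t\<^sup>p e\<^sup>-\<^sup>t\<close>\<close>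

text \<open>The exponent q - 1 follows the Gamma integral, so a factor t^m is absorbed by passing
  from q to q + m. This is why the inductions over the coefficients of \<open>P\<close> keep q
  arbitrary.\<close>

definition gamma_fun :: "real \<Rightarrow> real poly \<Rightarrow> real \<Rightarrow> real" where
  "gamma_fun q P t = (if t > 0 then t powr (q - 1) * exp (- t) * poly P t else 0)"

definition gamma_functional :: "real \<Rightarrow> real poly \<Rightarrow> real" where
  "gamma_functional q P = integral\<^sup>L lborel (gamma_fun q P)"

lemma has_bochner_integral_gamma_fun_const:
  assumes "q > 0"
  shows "has_bochner_integral lborel (gamma_fun q [:c:]) (c * Gamma q)"
proof -
  have "gamma_fun q [:c:] = (\<lambda>t. c * (if t > 0 then t powr (q - 1) * exp (- t) else 0))"
    by (auto simp: gamma_fun_def fun_eq_iff)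
  then show ?thesis
    using has_bochner_integral_mult_right[OF has_bochner_integral_Gamma[OF assms], of c] by simp
qed

lemma gamma_fun_pCons:
  "gamma_fun q (pCons a P) = (\<lambda>t. gamma_fun q [:a:] t + gamma_fun (q + 1) P t)"
proof
  fix t :: real
  have "t * t powr (q - 1) = t powr q" if "t > 0"
    using that powr_mult_base[of t "q - 1"] by simp
  then show "gamma_fun q (pCons a P) t = gamma_fun q [:a:] t + gamma_fun (q + 1) P t"
    by (auto simp: gamma_fun_def algebra_simps)
qed

lemma integrable_gamma_fun: "q > 0 \<Longrightarrow> integrable lborel (gamma_fun q P)"
proof (induction P arbitrary: q)
  case 0
  have "gamma_fun q 0 = (\<lambda>_. 0)" by (simp add: gamma_fun_def fun_eq_iff)
  then show ?case by simp
next
  case (pCons a P)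
  have "integrable lborel (gamma_fun q [:a:])"
    using has_bochner_integral_gamma_fun_const[OF pCons.prems, of a] by (simp add: has_bochner_integral_iff)
  then show ?case
    unfolding gamma_fun_pCons[of q a P] using pCons.IH[of "q + 1"] pCons.prems by simp
qed

lemma has_bochner_integral_gamma_fun:
  "q > 0 \<Longrightarrow> has_bochner_integral lborel (gamma_fun q P) (gamma_functional q P)"
  by (simp add: gamma_functional_def has_bochner_integral_iff integrable_gamma_fun)

lemma gamma_functional_const: "q > 0 \<Longrightarrow> gamma_functional q [:c:] = c * Gamma q"
  using has_bochner_integral_gamma_fun_const[of q c] by (simp add: gamma_functional_def has_bochner_integral_iff)

lemma gamma_functional_pCons:
  "q > 0 \<Longrightarrow> gamma_functional q (pCons a P) = a * Gamma q + gamma_functional (q + 1) P"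
  unfolding gamma_functional_def gamma_fun_pCons[of q a P]
  using gamma_functional_const[of q a]
  by (simp add: integrable_gamma_fun gamma_functional_def)

lemma gamma_functional_add:
  assumes "q > 0"
  shows "gamma_functional q (P + Q) = gamma_functional q P + gamma_functional q Q"
proof -
  have "gamma_fun q (P + Q) = (\<lambda>t. gamma_fun q P t + gamma_fun q Q t)"
    by (auto simp: gamma_fun_def algebra_simps)
  then show ?thesis by (simp add: gamma_functional_def integrable_gamma_fun assms)
qed

lemma gamma_functional_0 [simp]: "gamma_functional q 0 = 0"
proof -
  have "gamma_fun q 0 = (\<lambda>_. 0)" by (simp add: gamma_fun_def fun_eq_iff)
  then show ?thesis by (simp add: gamma_functional_def)
qed

lemma gamma_functional_smult: "gamma_functional q (smult c P) = c * gamma_functional q P"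
proof -
  have "gamma_fun q (smult c P) = (\<lambda>t. c * gamma_fun q P t)"
    by (auto simp: gamma_fun_def algebra_simps)
  then show ?thesis by (simp add: gamma_functional_def)
qed

text \<open>The left-hand side is the integral of the derivative of \<open>t\<^sup>q e\<^sup>-\<^sup>t P(t)\<close>.\<close>

lemma gamma_functional_derivative:
  "q > 0 \<Longrightarrow> gamma_functional q (smult q P + pCons 0 (pderiv P - P)) = 0"
proof (induction P arbitrary: q)
  case 0
  then show ?case using gamma_functional_const[of q 0] by simp
next
  case (pCons a P)
  \<comment> \<open>Splitting off the constant coefficient reproduces the same expression for
    \<open>P\<close> at q + 1, plus the constant -a. It remains to cancel q a Gamma(q) against a
    Gamma(q + 1).\<close>
  have eq: "smult q (pCons a P) + pCons 0 (pderiv (pCons a P) - pCons a P) =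
     pCons (q * a) ((smult (q + 1) P + pCons 0 (pderiv P - P)) + [:- a:])"
    by (simp add: pderiv_pCons smult_add_left)
  have "Gamma (q + 1) = q * Gamma q"
    using pCons.prems by (intro Gamma_plus1) (auto elim!: nonpos_Ints_cases)
  then show ?case
    unfolding eq using pCons.prems pCons.IH[of "q + 1"]
    by (simp add: gamma_functional_pCons gamma_functional_add gamma_functional_const del: pCons_0_0)
qed

text \<open>The polynomial factor in the m-th derivative of t^p exp(-t), that is, m! times the
  Laguerre polynomial of degree m with parameter p - m.\<close>

fun rodrigues_poly :: "real \<Rightarrow> nat \<Rightarrow> real poly" where
  "rodrigues_poly p 0 = 1"
| "rodrigues_poly p (Suc m) =
     smult (p - real m) (rodrigues_poly p m) + pCons 0 (pderiv (rodrigues_poly p m) - rodrigues_poly p m)"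

lemma deriv_powr_exp_poly:
  fixes t :: real
  assumes t: "t > 0"
  shows "((\<lambda>s. s powr q * exp (- s) * poly P s) has_field_derivative
    t powr (q - 1) * exp (- t) * poly (smult q P + pCons 0 (pderiv P - P)) t) (at t)"
proof -
  have "t powr q = t * t powr (q - 1)" using t powr_mult_base[of t "q - 1"] by simp
  moreover have "((\<lambda>s. s powr q * exp (- s) * poly P s) has_field_derivative
     (q * t powr (q - 1) * exp (- t) + - exp (- t) * t powr q) * poly P t + poly (pderiv P) t * (t powr q * exp (- t))) (at t)"
    using t by (auto intro!: derivative_eq_intros)
  ultimately show ?thesis by (simp add: algebra_simps)
qed

lemma higher_deriv_powr_exp:
  "t > 0 \<Longrightarrow> (deriv ^^ m) (\<lambda>s. s powr p * exp (- s)) t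
     = t powr (p - real m) * exp (- t) * poly (rodrigues_poly p m) t"
proof (induction m arbitrary: t)
  case (Suc m)
  let ?g = "\<lambda>s. s powr (p - real m) * exp (- s) * poly (rodrigues_poly p m) s"
  have "eventually (\<lambda>s. s > 0) (nhds t)"
    using Suc.prems by (rule eventually_nhds_in_open[of "{0<..}", simplified, OF open_greaterThan])
  then have "eventually (\<lambda>s. (deriv ^^ m) (\<lambda>s. s powr p * exp (- s)) s = ?g s) (nhds t)"
    by eventually_elim (rule Suc.IH)
  then have "(deriv ^^ Suc m) (\<lambda>s. s powr p * exp (- s)) t = deriv ?g t"
    by (simp add: deriv_cong_ev)
  also have "\<dots> = t powr (p - real m - 1) * exp (- t) * poly (rodrigues_poly p (Suc m)) t"
    unfolding rodrigues_poly.simps by (rule DERIV_imp_deriv[OF deriv_powr_exp_poly[OF Suc.prems]])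
  finally show ?case by (simp add: algebra_simps)
qed simp

text \<open>With q in place of p - m the recursion would produce a total derivative, whose integral
  is zero; the difference leaves the factor p - m - q.\<close>

lemma gamma_functional_rodrigues_poly:
  assumes q: "q > 0"
  shows "gamma_functional q (rodrigues_poly p m) = (\<Prod>i<m. p - real i - q) * Gamma q"
proof (induction m)
  case 0
  then show ?case using gamma_functional_const[OF q, of 1] by (simp add: one_pCons)
next
  case (Suc m)
  let ?P = "rodrigues_poly p m"
  define D where "D = smult q ?P + pCons 0 (pderiv ?P - ?P)"
  have "rodrigues_poly p (Suc m) = D + smult (p - real m - q) ?P"
    by (simp add: D_def smult_diff_left)
  moreover have "gamma_functional q D = 0"
    unfolding D_def by (rule gamma_functional_derivative[OF q])
  ultimately have "gamma_functional q (rodrigues_poly p (Suc m)) = (p - real m - q) * gamma_functional q ?P"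
    by (simp only: gamma_functional_add[OF q] gamma_functional_smult add_0)
  then show ?case using Suc by simp
qed

text \<open>The parameter q arises from testing the N-th derivative of t^p exp(-t) against t^r,
  since t^(p-N) t^r = t^(q-1). An N-fold derivative is orthogonal to powers below N.\<close>

lemma gamma_functional_rodrigues_poly_eq_0:
  assumes "p - real N + 1 + real r > 0" and "r < N"
  shows "gamma_functional (p - real N + 1 + real r) (rodrigues_poly p N) = 0"
proof -
  have "(\<Prod>i<N. p - real i - (p - real N + 1 + real r)) = 0"
  proof (rule prod_zero)
    \<comment> \<open>The factor with index i equals N - 1 - r - i.\<close>
    show "\<exists>i\<in>{..<N}. p - real i - (p - real N + 1 + real r) = 0"
      using assms(2) by (intro bexI[of _ "N - 1 - r"]) (auto simp: of_nat_diff)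
  qed simp
  then show ?thesis using gamma_functional_rodrigues_poly[OF assms(1)] by simp
qed

text \<open>The case r = N of the same pairing: the factors are -1, ..., -N.\<close>

lemma gamma_functional_rodrigues_poly_top:
  assumes "p + 1 > 0"
  shows "gamma_functional (p + 1) (rodrigues_poly p N) = (- 1) ^ N * fact N * Gamma (p + 1)"
proof -
  have "(\<Prod>i<N. p - real i - (p + 1)) = (- 1) ^ N * fact N"
    by (induction N) (simp_all add: algebra_simps)
  then show ?thesis using gamma_functional_rodrigues_poly[OF assms] by simp
qed

section \<open>Integrals over the cone\<close>

text \<open>Coordinates x = t y, with Jacobian t^d placed in the integral for \<open>H\<close>. The
  vanishing of \<open>g\<close> for |y| \<ge> 1 and of \<open>h\<close> for t \<le> 0 makes the
  product extend the integrand by zero outside the cone.\<close>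

lemma has_bochner_integral_solid_cone:
  fixes F :: "real^'n \<Rightarrow> real \<Rightarrow> real"
  assumes g: "has_bochner_integral lborel g G" and h: "h \<in> borel_measurable borel"
    and H: "has_bochner_integral lborel (\<lambda>t. h t * t ^ CARD('n)) H"
    and g0: "\<And>y. norm y \<ge> 1 \<Longrightarrow> g y = 0" and h0: "\<And>t. t \<le> 0 \<Longrightarrow> h t = 0"
    and F: "\<And>x t. norm x \<le> t \<Longrightarrow> F x t = g (x /\<^sub>R t) * h t"
  shows "has_bochner_integral lborel (\<lambda>z. indicator solid_cone z *\<^sub>R F (fst z) (snd z)) (G * H)"
proof -
  have "has_bochner_integral lborel (\<lambda>z. g (fst z /\<^sub>R snd z) * h (snd z)) (G * H)"
  proof (rule has_bochner_integral_scaled_product[OF g h, where \<rho> = "\<lambda>t. t"])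
    show "0 < t" if "h t \<noteq> 0" for t
      using h0[of t] that by (cases "t \<le> 0") auto
  qed (use H in simp_all)
  also have "(\<lambda>z. g (fst z /\<^sub>R snd z) * h (snd z)) = (\<lambda>z. indicator solid_cone z *\<^sub>R F (fst z) (snd z))"
  proof
    fix z :: "(real^'n) \<times> real"
    obtain x t where z: "z = (x, t)" by (cases z)
    show "g (fst z /\<^sub>R snd z) * h (snd z) = indicator solid_cone z *\<^sub>R F (fst z) (snd z)"
    proof (cases "norm x \<le> t")
      case True
      then show ?thesis by (simp add: z F solid_cone_def)
    next
      case False
      then have "norm (x /\<^sub>R t) \<ge> 1" if "t > 0" using that by (simp add: divide_simps)
      then have "t \<le> 0 \<or> norm (x /\<^sub>R t) \<ge> 1" by linarith
      then show ?thesis using False g0 h0 by (auto simp: z solid_cone_def)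
    qed
  qed
  finally show ?thesis .
qed

lemma cone_integral_eqI:
  "has_bochner_integral lborel (\<lambda>z. indicator solid_cone z *\<^sub>R F (fst z) (snd z)) I \<Longrightarrow> cone_integral F = I"
  by (simp add: cone_integral_def set_lebesgue_integral_def has_bochner_integral_iff)

lemma gamma_fun_mult_power: "gamma_fun q P t * t ^ m = gamma_fun (q + real m) P t"
proof (cases "t > 0")
  case True
  then have "t powr (q + real m - 1) = t powr (q - 1) * t ^ m"
    by (simp add: powr_realpow[symmetric] algebra_simps flip: powr_add)
  then show ?thesis using True by (simp add: gamma_fun_def)
qed (simp add: gamma_fun_def)

lemma borel_measurable_gamma_fun [measurable]: "gamma_fun q P \<in> borel_measurable borel"
proof -
  have "(\<lambda>t. if t > 0 then t powr c * exp (- t) * poly P t else 0) \<in> borel_measurable borel" for c :: real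
  proof -
    have [measurable]: "poly P \<in> borel_measurable borel"
      by (intro borel_measurable_continuous_onI continuous_intros)
    show ?thesis by measurable
  qed
  then show ?thesis unfolding gamma_fun_def by blast
qed

text \<open>By the convention \<open>0 powr r = 0\<close>, also for negative r, the weight is zero
  on the boundary even where it blows up nearby. Identities can thus be checked on the closed
  cone.\<close>

lemma weight_eq_0: "norm x = t \<Longrightarrow> weight \<beta> \<mu> x t = 0"
  by (simp add: weight_def)

lemma weight_pos: "norm x < t \<Longrightarrow> weight \<beta> \<mu> x t > 0"
proof -
  assume x: "norm x < t"
  then have "t > 0" using norm_ge_zero[of x] by linarith
  moreover have "t\<^sup>2 - (norm x)\<^sup>2 > 0" using x by (simp add: power_strict_mono)
  ultimately show ?thesis
    unfolding weight_def by (intro mult_pos_pos) (simp_all del: power_strict_mono add: less_imp_neq[symmetric])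
qed

text \<open>With x = t y the integrand separates. The power of t collects 2 \<mu> - 1 from t^2 -
  |x|^2, then \<beta>, |a| and i; the Jacobian adds d.\<close>

lemma has_bochner_integral_weight_monomial:
  fixes a :: "'n::finite \<Rightarrow> nat"
  assumes \<mu>: "\<mu> > - 1/2" and pos: "2 * \<mu> + \<beta> + real CARD('n) > 0"
  shows "has_bochner_integral lborel
     (\<lambda>z. indicator solid_cone z *\<^sub>R (mpow (fst z) a * snd z ^ i * weight \<beta> \<mu> (fst z) (snd z)))
     (ball_moment (\<mu> - 1/2) a * Gamma (2 * \<mu> + \<beta> + real CARD('n) + real (mdeg a) + real i))"
proof -
  define q where "q = 2 * \<mu> + \<beta> + real (mdeg a) + real i"
  show ?thesis
  proof (rule has_bochner_integral_solid_cone[where F = "\<lambda>x t. mpow x a * t ^ i * weight \<beta> \<mu> x t"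
        and g = "ball_fun (\<mu> - 1/2) a" and h = "gamma_fun q 1"])
    show "has_bochner_integral lborel (ball_fun (\<mu> - 1/2) a) (ball_moment (\<mu> - 1/2) a)"
      using \<mu> by (intro has_bochner_integral_ball_fun) simp
    have q: "q + real CARD('n) > 0" using pos by (simp add: q_def)
    have "Gamma (q + real CARD('n)) = gamma_functional (q + real CARD('n)) 1"
      using gamma_functional_const[OF q, of 1] by (simp add: one_pCons)
    then show "has_bochner_integral lborel (\<lambda>t. gamma_fun q 1 t * t ^ CARD('n))
        (Gamma (2 * \<mu> + \<beta> + real CARD('n) + real (mdeg a) + real i))"
      using has_bochner_integral_gamma_fun[OF q, of 1] by (simp add: gamma_fun_mult_power q_def add_ac)
    fix x :: "real^'n" and t :: real
    assume "norm x \<le> t"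
    then consider "t = norm x" | "norm x < t" by linarith
    then show "mpow x a * t ^ i * weight \<beta> \<mu> x t = ball_fun (\<mu> - 1/2) a (x /\<^sub>R t) * gamma_fun q 1 t"
    proof cases
      case 1
      then show ?thesis by (cases "t = 0") (simp_all add: weight_eq_0 gamma_fun_def ball_fun_def)
    next
      case 2
      define y where "y = x /\<^sub>R t"
      have t: "t > 0" using 2 norm_ge_zero[of x] by linarith
      have xy: "x = t *\<^sub>R y" using t by (simp add: y_def)
      have "norm x = t * norm y" using t by (simp add: xy)
      then have ny: "norm y < 1" using 2 t by simp
      then have p: "1 - (norm y)\<^sup>2 > 0" by (simp add: power_less_one_iff)
      have "t\<^sup>2 - (norm x)\<^sup>2 = t\<^sup>2 * (1 - (norm y)\<^sup>2)"
        by (simp add: xy power_mult_distrib algebra_simps)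
      then have e1: "(t\<^sup>2 - (norm x)\<^sup>2) powr (\<mu> - 1/2) = (t\<^sup>2) powr (\<mu> - 1/2) * (1 - (norm y)\<^sup>2) powr (\<mu> - 1/2)"
        using p t by (simp add: powr_mult)
      have e2: "(t\<^sup>2) powr (\<mu> - 1/2) = t powr (2 * \<mu> - 1)"
      proof -
        have "t\<^sup>2 = t powr 2" using t by simp
        then show ?thesis by (simp only: powr_powr) (simp add: algebra_simps)
      qed
      have e3: "mpow x a * t ^ i = t powr real (mdeg a) * t powr real i * mpow y a"
        using t by (simp add: xy mpow_scaleR powr_realpow)
      have "q - 1 = real (mdeg a) + real i + (2 * \<mu> - 1) + \<beta>" by (simp add: q_def)
      then have e4: "t powr (q - 1) = t powr real (mdeg a) * t powr real i * t powr (2 * \<mu> - 1) * t powr \<beta>"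
        by (simp only: powr_add)
      show ?thesis
        unfolding weight_def y_def[symmetric] ball_fun_def gamma_fun_def e1 e2 e3 e4
        using ny t by simp
    qed
  qed (auto simp: ball_fun_def gamma_fun_def)
qed

lemma has_bochner_integral_laguerre_U_monomial:
  fixes a k :: "'n::finite \<Rightarrow> nat"
  assumes \<mu>: "\<mu> > - 1/2" and pos: "2 * \<mu> + \<beta> + real CARD('n) > 0" and kn: "mdeg k \<le> n"
  defines "s \<equiv> 2 * \<mu> + \<beta> + real CARD('n)"
  defines "p \<equiv> real (mdeg k) + \<mu> - 1/2"
  shows "has_bochner_integral lborel
     (\<lambda>z. indicator solid_cone z *\<^sub>R
       (laguerre_U \<beta> \<mu> k n (fst z) (snd z) * (mpow (fst z) a * snd z ^ i) * weight \<beta> \<mu> (fst z) (snd z)))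
     (radial_moment p (rodrigues_radial p k) a
      * gamma_functional (s + real (mdeg k) + real (mdeg a) + real i)
          (rodrigues_poly (s + real n + real (mdeg k) - 1) (n - mdeg k)))"
proof -
  define N where "N = n - mdeg k"
  define p' where "p' = s + real n + real (mdeg k) - 1"
  define P where "P = rodrigues_poly p' N"
  \<comment> \<open>One plus the total power of t: -(2 |k| + 2 \<mu> + d - 1) from the prefactor, 2
    p - |k| from the homogeneous x-derivative, p' - N from the t-derivative, and |a| + i from the
    monomial.\<close>
  define q where "q = s - real CARD('n) + real (mdeg k) + real (mdeg a) + real i"
  let ?L = "rodrigues_radial p k"
  define g where "g y = (if norm y < 1 then radial_eval p 1 ?L y * mpow y a else 0)" for y :: "real^'n"
  have n: "real n = real N + real (mdeg k)" using kn by (simp add: N_def of_nat_diff)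
  have "has_bochner_integral lborel
     (\<lambda>z. indicator solid_cone z *\<^sub>R
       (laguerre_U \<beta> \<mu> k n (fst z) (snd z) * (mpow (fst z) a * snd z ^ i) * weight \<beta> \<mu> (fst z) (snd z)))
     (radial_moment p ?L a * gamma_functional (q + real CARD('n)) P)"
  proof (rule has_bochner_integral_solid_cone[where g = g and h = "gamma_fun q P"
       and F = "\<lambda>x t. laguerre_U \<beta> \<mu> k n x t * (mpow x a * t ^ i) * weight \<beta> \<mu> x t"])
    show "has_bochner_integral lborel g (radial_moment p ?L a)"
      unfolding g_def using \<mu>
      by (intro has_bochner_integral_radial_eval[OF radial_homogeneous_rodrigues]) (simp add: p_def)
    have q: "q + real CARD('n) > 0" using pos by (simp add: q_def s_def)
    then show "has_bochner_integral lborel (\<lambda>t. gamma_fun q P t * t ^ CARD('n)) (gamma_functional (q + real CARD('n)) P)"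
      unfolding gamma_fun_mult_power by (rule has_bochner_integral_gamma_fun)
    fix x :: "real^'n" and t :: real
    assume "norm x \<le> t"
    then consider "t = norm x" | "norm x < t" by linarith
    then show "laguerre_U \<beta> \<mu> k n x t * (mpow x a * t ^ i) * weight \<beta> \<mu> x t = g (x /\<^sub>R t) * gamma_fun q P t"
    proof cases
      \<comment> \<open>On the boundary the left side vanishes by the weight, the right side because
        |y| = 1 or t = 0.\<close>
      case 1
      then show ?thesis by (cases "t = 0") (simp_all add: weight_eq_0 gamma_fun_def g_def)
    next
      case 2
      define y where "y = x /\<^sub>R t"
      have t: "t > 0" using 2 norm_ge_zero[of x] by linarith
      have xy: "x = t *\<^sub>R y" using t by (simp add: y_def)
      have "norm x = t * norm y" using t by (simp add: xy)
      then have ny: "norm y < 1" using 2 t by simp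
      have w: "weight \<beta> \<mu> x t \<noteq> 0" using weight_pos[OF 2, of \<beta> \<mu>] by simp
      define b where "b = 2 * real (mdeg k) + 2 * \<mu> + real CARD('n) - 1"
      have pp: "real n + real (mdeg k) + \<beta> + 2 * \<mu> + real CARD('n) - 1 = p'"
        by (simp add: p'_def s_def)
      have e1: "multi_deriv k (\<lambda>y. (t\<^sup>2 - (norm y)\<^sup>2) powr p) x
          = t powr (2 * p - real (mdeg k)) * radial_eval p 1 ?L y"
        unfolding multi_deriv_radial[OF 2] y_def by (rule radial_eval_scale[OF radial_homogeneous_rodrigues 2])
      have e2: "(deriv ^^ N) (\<lambda>s. s powr p' * exp (- s)) t = t powr (p' - real N) * exp (- t) * poly P t"
        unfolding P_def by (rule higher_deriv_powr_exp[OF t])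
      have e3: "mpow x a * t ^ i = t powr real (mdeg a) * t powr real i * mpow y a"
        using t by (simp add: xy mpow_scaleR powr_realpow)
      have "q - 1 = - b + (2 * p - real (mdeg k)) + (p' - real N) + real (mdeg a) + real i"
        by (simp add: q_def b_def p_def p'_def s_def n)
      then have e4: "t powr (q - 1) = t powr (- b) * t powr (2 * p - real (mdeg k)) * t powr (p' - real N)
           * t powr real (mdeg a) * t powr real i"
        by (simp only: powr_add)
      have e5: "1 / t powr b = t powr (- b)" using t by (simp add: powr_minus divide_inverse)
      have "laguerre_U \<beta> \<mu> k n x t * (mpow x a * t ^ i) * weight \<beta> \<mu> x t
         = t powr (- b) * (t powr (2 * p - real (mdeg k)) * radial_eval p 1 ?L y)
           * (t powr (p' - real N) * exp (- t) * poly P t) * (t powr real (mdeg a) * t powr real i * mpow y a)"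
        unfolding laguerre_U_def pp b_def[symmetric] p_def[symmetric] N_def[symmetric] e1 e2 e3 e5
        using w by simp
      also have "\<dots> = g y * gamma_fun q P t"
        unfolding g_def gamma_fun_def e4 using ny t by simp
      finally show ?thesis by (simp only: y_def)
    qed
  qed (auto simp: g_def gamma_fun_def)
  then show ?thesis
    by (simp add: q_def P_def p'_def N_def add_ac)
qed

text \<open>If some a_j < k_j, the ball factor is zero. Otherwise |k| \<le> |a|, and the t factor
  pairs n - |k| derivatives with the power |a| + i - |k|, which is below n - |k|.\<close>

lemma laguerre_U_monomial_eq_0:
  fixes a k :: "'n::finite \<Rightarrow> nat"
  assumes \<mu>: "\<mu> > - 1/2" and pos: "2 * \<mu> + \<beta> + real CARD('n) > 0" and kn: "mdeg k \<le> n" and less: "mdeg a + i < n"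
  shows "has_bochner_integral lborel
     (\<lambda>z. indicator solid_cone z *\<^sub>R
       (laguerre_U \<beta> \<mu> k n (fst z) (snd z) * (mpow (fst z) a * snd z ^ i) * weight \<beta> \<mu> (fst z) (snd z))) 0"
proof -
  define s where "s = 2 * \<mu> + \<beta> + real CARD('n)"
  define p where "p = real (mdeg k) + \<mu> - 1/2"
  have p: "p + 1 > real (mdeg k)" using \<mu> by (simp add: p_def)
  have V: "radial_moment p (rodrigues_radial p k) a
      * gamma_functional (s + real (mdeg k) + real (mdeg a) + real i)
          (rodrigues_poly (s + real n + real (mdeg k) - 1) (n - mdeg k)) = 0"
  proof (cases "\<forall>j. k j \<le> a j")
    case False
    then obtain j where "a j < k j" by (auto simp: not_le)
    then have "(\<Prod>i\<in>UNIV. real (a i choose k i)) = 0" by (auto intro!: exI[of _ j] simp: binomial_eq_0)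
    then show ?thesis by (simp add: radial_moment_rodrigues[OF p])
  next
    case True
    then have le: "mdeg k \<le> mdeg a" unfolding mdeg_def by (intro sum_mono) auto
    define r where "r = mdeg a + i - mdeg k"
    have "r < n - mdeg k" using less le kn by (simp add: r_def)
    moreover have eq: "s + real n + real (mdeg k) - 1 - real (n - mdeg k) + 1 + real r
       = s + real (mdeg k) + real (mdeg a) + real i"
      using le kn by (simp add: r_def of_nat_diff)
    moreover have "s + real (mdeg k) + real (mdeg a) + real i > 0" using pos by (simp add: s_def add_pos_nonneg)
    ultimately show ?thesis
      using gamma_functional_rodrigues_poly_eq_0[of "s + real n + real (mdeg k) - 1" "n - mdeg k" r]
      unfolding eq by (simp only: mult_zero_right)
  qed
  show ?thesis
    using has_bochner_integral_laguerre_U_monomial[OF \<mu> pos kn, of a i]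
    unfolding s_def[symmetric] p_def[symmetric] V .
qed

section \<open>Polynomials and monomial orthogonal polynomials\<close>

text \<open>Gram-Schmidt by induction on the index set, applied to \<open>f\<close> and to the new
  vector. Linearity is demanded only on \<open>X\<close>, since for the integral it needs
  integrability. The vectors may be linearly dependent.\<close>

lemma orthogonal_projection_exists:
  fixes e :: "'i \<Rightarrow> 'x \<Rightarrow> real" and B :: "('x \<Rightarrow> real) \<Rightarrow> ('x \<Rightarrow> real) \<Rightarrow> real"
  assumes closed: "\<And>f g c. f \<in> X \<Longrightarrow> g \<in> X \<Longrightarrow> (\<lambda>x. f x + c * g x) \<in> X"
    and lin: "\<And>f g h c. f \<in> X \<Longrightarrow> g \<in> X \<Longrightarrow> h \<in> X \<Longrightarrow> B (\<lambda>x. f x + c * g x) h = B f h + c * B g h"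
    and sym: "\<And>f g. B f g = B g f"
    and definite: "\<And>f. f \<in> X \<Longrightarrow> B f f = 0 \<Longrightarrow> f = (\<lambda>_. 0)"
    and I: "finite I" and e: "\<And>i. i \<in> I \<Longrightarrow> e i \<in> X" and f: "f \<in> X"
  shows "\<exists>c. (\<lambda>x. f x - (\<Sum>i\<in>I. c i * e i x)) \<in> X \<and> (\<forall>j\<in>I. B (\<lambda>x. f x - (\<Sum>i\<in>I. c i * e i x)) (e j) = 0)"
  using I e f
proof (induction I arbitrary: f rule: finite_induct)
  case empty
  then show ?case by simp
next
  case (insert b I)
  have eb: "e b \<in> X" using insert.prems by simp
  obtain c where c: "(\<lambda>x. f x - (\<Sum>i\<in>I. c i * e i x)) \<in> X"
    "\<And>j. j \<in> I \<Longrightarrow> B (\<lambda>x. f x - (\<Sum>i\<in>I. c i * e i x)) (e j) = 0"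
    using insert.IH[of f] insert.prems by auto
  obtain d where d: "(\<lambda>x. e b x - (\<Sum>i\<in>I. d i * e i x)) \<in> X"
    "\<And>j. j \<in> I \<Longrightarrow> B (\<lambda>x. e b x - (\<Sum>i\<in>I. d i * e i x)) (e j) = 0"
    using insert.IH[of "e b"] insert.prems by auto
  define u where "u = (\<lambda>x. f x - (\<Sum>i\<in>I. c i * e i x))"
  define v where "v = (\<lambda>x. e b x - (\<Sum>i\<in>I. d i * e i x))"
  have u: "u \<in> X" "\<And>j. j \<in> I \<Longrightarrow> B u (e j) = 0" using c by (simp_all add: u_def)
  have v: "v \<in> X" "\<And>j. j \<in> I \<Longrightarrow> B v (e j) = 0" using d by (simp_all add: v_def)
  have zero: "(\<lambda>_. 0) \<in> X" and B0: "B (\<lambda>_. 0) h = 0" if "h \<in> X" for h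
    using closed[OF eb eb, of "-1"] lin[OF eb eb that, of "-1"] by simp_all
  \<comment> \<open>Linearity is available for two summands only, so the sum is removed term by
    term; symmetry transfers it to the second argument.\<close>
  have sub: "(\<lambda>x. e b x - (\<Sum>i\<in>J. d i * e i x)) \<in> X \<and> B h (\<lambda>x. e b x - (\<Sum>i\<in>J. d i * e i x)) = B h (e b)"
    if h: "h \<in> X" "\<And>j. j \<in> I \<Longrightarrow> B h (e j) = 0" and J: "J \<subseteq> I" for h J
  proof -
    have "finite J" using J insert.hyps finite_subset by blast
    then show ?thesis using J
    proof (induction J rule: finite_induct)
      case empty
      then show ?case using eb by simp
    next
      case (insert j J)
      let ?w = "\<lambda>x. e b x - (\<Sum>i\<in>J. d i * e i x)"
      have ej: "e j \<in> X" using insert.prems \<open>\<And>i. i \<in> insert b I \<Longrightarrow> e i \<in> X\<close> by auto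
      have w: "?w \<in> X" "B h ?w = B h (e b)" using insert.IH insert.prems by auto
      have "(\<lambda>x. e b x - (\<Sum>i\<in>insert j J. d i * e i x)) = (\<lambda>x. ?w x + (- d j) * e j x)"
        using insert.hyps by (auto simp: algebra_simps)
      then show ?case
        using closed[OF w(1) ej, of "- d j"] lin[OF w(1) ej h(1), of "- d j"] w(2) h(2)[of j] insert.prems
        by (simp add: sym[of h])
    qed
  qed
  have Bhv: "B h v = B h (e b)" if "h \<in> X" "\<And>j. j \<in> I \<Longrightarrow> B h (e j) = 0" for h
    using sub[OF that subset_refl] by (simp add: v_def)
  \<comment> \<open>In the dependent case v = 0, so the numerator of \<open>\<alpha>\<close>
    vanishes with its denominator and the default value of division by zero is a correct
    coefficient.\<close>
  have deg: "B u (e b) = 0" if "B v (e b) = 0"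
  proof -
    have "B v v = 0" using Bhv[OF v] that by simp
    then have "v = (\<lambda>_. 0)" by (rule definite[OF v(1)])
    then have "B u v = 0" using B0[OF u(1)] sym by metis
    then show ?thesis using Bhv[OF u] by simp
  qed
  define \<alpha> where "\<alpha> = B u (e b) / B v (e b)"
  define c' where "c' i = (if i = b then \<alpha> else c i - \<alpha> * d i)" for i
  have "(\<Sum>i\<in>I. c' i * e i x) = (\<Sum>i\<in>I. c i * e i x) - \<alpha> * (\<Sum>i\<in>I. d i * e i x)" for x
  proof -
    have "(\<Sum>i\<in>I. c' i * e i x) = (\<Sum>i\<in>I. c i * e i x - \<alpha> * (d i * e i x))"
      using insert.hyps by (intro sum.cong) (auto simp: c'_def algebra_simps)
    then show ?thesis by (simp add: sum_subtractf sum_distrib_left)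
  qed
  then have eq: "(\<lambda>x. f x - (\<Sum>i\<in>insert b I. c' i * e i x)) = (\<lambda>x. u x + (- \<alpha>) * v x)"
    using insert.hyps by (auto simp: u_def v_def c'_def algebra_simps)
  have "B (\<lambda>x. u x + (- \<alpha>) * v x) (e j) = 0" if "j \<in> insert b I" for j
  proof -
    have ej: "e j \<in> X" using that insert.prems by auto
    have "B u (e j) = \<alpha> * B v (e j)"
      using that u(2) v(2) deg by (cases "j = b") (auto simp: \<alpha>_def)
    then show ?thesis using lin[OF u(1) v(1) ej, of "- \<alpha>"] by simp
  qed
  moreover have "(\<lambda>x. u x + (- \<alpha>) * v x) \<in> X" by (rule closed[OF u(1) v(1)])
  ultimately show ?case unfolding eq[symmetric] by blast
qed

section \<open>Polynomial functions of bounded degree and the weighted inner product\<close>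

lemma finite_monomials: "finite {(a :: 'n::finite \<Rightarrow> nat, i). mdeg a + i < m}"
proof -
  have "a j \<le> mdeg a" for a :: "'n \<Rightarrow> nat" and j
    unfolding mdeg_def by (rule member_le_sum) auto
  then have "{(a :: 'n \<Rightarrow> nat, i). mdeg a + i < m} \<subseteq> (PiE UNIV (\<lambda>_. {..<m})) \<times> {..<m}"
    by (auto simp: PiE_iff) (metis add_lessD1 le_less_trans)
  then show ?thesis
    by (rule finite_subset) (intro finite_cartesian_product finite_PiE; simp)
qed

lemma polys_deg_lessI:
  "(\<And>x t. p x t = (\<Sum>(a, i) | mdeg a + i < m. c a i * mpow x a * t ^ i)) \<Longrightarrow> p \<in> polys_deg_less m"
  unfolding polys_deg_less_def by (auto simp: fun_eq_iff)

lemma polys_deg_lessD: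
  "p \<in> polys_deg_less m \<Longrightarrow> \<exists>c. \<forall>x t. p x t = (\<Sum>(a, i) | mdeg a + i < m. c a i * mpow x a * t ^ i)"
  unfolding polys_deg_less_def by (auto simp: fun_eq_iff)

lemma polys_deg_less_mono:
  assumes "p \<in> polys_deg_less m" and "m \<le> m'"
  shows "p \<in> polys_deg_less m'"
proof -
  obtain c where c: "\<And>x t. p x t = (\<Sum>(a, i) | mdeg a + i < m. c a i * mpow x a * t ^ i)"
    using polys_deg_lessD[OF assms(1)] by blast
  show ?thesis
  proof (rule polys_deg_lessI)
    fix x t
    show "p x t = (\<Sum>(a, i) | mdeg a + i < m'. (if mdeg a + i < m then c a i else 0) * mpow x a * t ^ i)"
      unfolding c using assms(2)
      by (intro sum.mono_neutral_cong_left finite_monomials) (auto split: if_splits)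
  qed
qed

lemma polys_deg_less_lincomb:
  assumes "p \<in> polys_deg_less m" and "q \<in> polys_deg_less m"
  shows "(\<lambda>x t. p x t + r * q x t) \<in> polys_deg_less m"
proof -
  obtain c where c: "\<And>x t. p x t = (\<Sum>(a, i) | mdeg a + i < m. c a i * mpow x a * t ^ i)"
    using polys_deg_lessD[OF assms(1)] by blast
  obtain d where d: "\<And>x t. q x t = (\<Sum>(a, i) | mdeg a + i < m. d a i * mpow x a * t ^ i)"
    using polys_deg_lessD[OF assms(2)] by blast
  show ?thesis
  proof (rule polys_deg_lessI)
    fix x t
    show "p x t + r * q x t = (\<Sum>(a, i) | mdeg a + i < m. (c a i + r * d a i) * mpow x a * t ^ i)"
      unfolding c d sum_distrib_left sum.distrib[symmetric]
      by (rule sum.cong[OF refl]) (auto simp: algebra_simps)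
  qed
qed

lemma monomial_in_polys_deg_less:
  assumes "mdeg a + i < m"
  shows "(\<lambda>x t. mpow x a * t ^ i) \<in> polys_deg_less m"
proof (rule polys_deg_lessI)
  fix x :: "real^'a" and t :: real
  have "(\<Sum>(a', i') | mdeg a' + i' < m. (if (a', i') = (a, i) then 1 else 0) * mpow x a' * t ^ i')
    = (\<Sum>z | mdeg (fst z) + snd z < m. if z = (a, i) then mpow x a * t ^ i else 0)"
    by (intro sum.cong) (auto split: if_splits)
  also have "\<dots> = mpow x a * t ^ i"
    using assms finite_monomials[where 'n = 'a, of m] by (simp add: sum.delta case_prod_unfold)
  finally show "mpow x a * t ^ i = (\<Sum>(a', i') | mdeg a' + i' < m. (if (a', i') = (a, i) then 1 else 0) * mpow x a' * t ^ i')"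
    by simp
qed

text \<open>The restriction of a polynomial to the line through the interior point \<open>(0, 1)\<close> and \<open>(x, t)\<close>.\<close>

lemma poly_along_ray:
  fixes x :: "real^'n" and c :: "('n \<Rightarrow> nat) \<Rightarrow> nat \<Rightarrow> real"
  shows "poly (\<Sum>(a, i) | mdeg a + i < m. smult (c a i) ((\<Prod>j\<in>UNIV. [:0, x $ j:] ^ a j) * [:1, t - 1:] ^ i)) s
    = (\<Sum>(a, i) | mdeg a + i < m. c a i * mpow (s *\<^sub>R x) a * (1 + s * (t - 1)) ^ i)"
proof -
  have "poly (\<Prod>j\<in>UNIV. [:0, x $ j:] ^ a j) s = mpow (s *\<^sub>R x) a" for a
    unfolding poly_prod mpow_def by (rule prod.cong[OF refl]) simp
  then show ?thesis
    unfolding poly_sum split_beta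
    by (intro sum.cong[OF refl]) (simp only: poly_smult poly_mult poly_power, simp)
qed

text \<open>On the line from (0, 1) to (x, t) all points with small positive parameter lie in the
  open cone. The restricted polynomial has infinitely many zeros, hence vanishes at parameter 1
  too.\<close>

lemma polys_deg_less_vanish_on_cone:
  fixes p :: "real^'n \<Rightarrow> real \<Rightarrow> real"
  assumes "p \<in> polys_deg_less m" and zero: "\<And>x t. norm x < t \<Longrightarrow> p x t = 0"
  shows "p x t = 0"
proof -
  obtain c where c: "\<And>x t. p x t = (\<Sum>(a, i) | mdeg a + i < m. c a i * mpow x a * t ^ i)"
    using polys_deg_lessD[OF assms(1)] by blast
  define P where "P = (\<Sum>(a, i) | mdeg a + i < m. smult (c a i) ((\<Prod>j\<in>UNIV. [:0, x $ j:] ^ a j) * [:1, t - 1:] ^ i))"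
  have P: "poly P s = p (s *\<^sub>R x) (1 + s * (t - 1))" for s
    unfolding P_def c by (rule poly_along_ray)
  \<comment> \<open>For 0 < s < \<open>\<delta>\<close> one has s (|x| + |t| + 1) < 1, which gives s
    |x| < 1 + s (t - 1).\<close>
  define \<delta> where "\<delta> = 1 / (norm x + \<bar>t\<bar> + 1)"
  have d: "norm x + \<bar>t\<bar> + 1 > 0" by (simp add: add_nonneg_pos)
  have "poly P s = 0" if "s \<in> {0<..<\<delta>}" for s
  proof -
    have "s * (norm x + \<bar>t\<bar> + 1) < 1" using that d by (simp add: \<delta>_def pos_less_divide_eq)
    moreover have "s * (- t) \<le> s * \<bar>t\<bar>" using that by (intro mult_left_mono) auto
    ultimately have "norm (s *\<^sub>R x) < 1 + s * (t - 1)" using that by (simp add: algebra_simps)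
    then show ?thesis by (simp add: P zero)
  qed
  then have "{0<..<\<delta>} \<subseteq> {s. poly P s = 0}" by auto
  moreover have "infinite {0<..<\<delta>}" using d by (intro infinite_Ioo) (simp add: \<delta>_def)
  ultimately have "P = 0" using poly_roots_finite[of P] finite_subset by metis
  then show ?thesis using P[of 1] by simp
qed

lemma continuous_on_polys:
  fixes p :: "real^'n \<Rightarrow> real \<Rightarrow> real"
  assumes "p \<in> polys_deg_less m"
  shows "continuous_on A (\<lambda>z. p (fst z) (snd z))"
proof -
  obtain c where c: "\<And>x t. p x t = (\<Sum>(a, i) | mdeg a + i < m. c a i * mpow x a * t ^ i)"
    using polys_deg_lessD[OF assms] by blast
  have "continuous_on A (\<lambda>z. mpow (fst z) a)" for a :: "'n \<Rightarrow> nat"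
    unfolding mpow_def by (rule continuous_on_prod) (intro continuous_intros)
  then have "continuous_on A (\<lambda>z. c (fst b) (snd b) * mpow (fst z) (fst b) * snd z ^ snd b)" for b
    by (intro continuous_on_mult continuous_on_power continuous_on_const continuous_on_snd continuous_on_id)
  then show ?thesis
    unfolding c split_beta by (rule continuous_on_sum)
qed

lemma integrable_polys_weight:
  fixes p q :: "real^'n \<Rightarrow> real \<Rightarrow> real"
  assumes \<mu>: "\<mu> > - 1/2" and pos: "2 * \<mu> + \<beta> + real CARD('n) > 0"
    and p: "p \<in> polys_deg_less m" and q: "q \<in> polys_deg_less m'"
  shows "integrable lborel (\<lambda>z. indicator solid_cone z *\<^sub>R
    (p (fst z) (snd z) * q (fst z) (snd z) * weight \<beta> \<mu> (fst z) (snd z)))"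
proof -
  obtain c where c: "\<And>x t. p x t = (\<Sum>(a, i) | mdeg a + i < m. c a i * mpow x a * t ^ i)"
    using polys_deg_lessD[OF p] by blast
  obtain d where d: "\<And>x t. q x t = (\<Sum>(a, i) | mdeg a + i < m'. d a i * mpow x a * t ^ i)"
    using polys_deg_lessD[OF q] by blast
  define M where "M a i z = indicator solid_cone z *\<^sub>R (mpow (fst z) a * snd z ^ i * weight \<beta> \<mu> (fst z) (snd z))"
    for a :: "'n \<Rightarrow> nat" and i and z :: "(real^'n) \<times> real"
  have M: "integrable lborel (M a i)" for a i
    using has_bochner_integral_weight_monomial[OF \<mu> pos, of a i]
    unfolding M_def has_bochner_integral_iff by simp
  let ?I = "\<lambda>m. {(a :: 'n \<Rightarrow> nat, i). mdeg a + i < m}"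
  have "indicator solid_cone z *\<^sub>R (p (fst z) (snd z) * q (fst z) (snd z) * weight \<beta> \<mu> (fst z) (snd z))
     = (\<Sum>\<alpha>\<in>?I m. \<Sum>\<gamma>\<in>?I m'. (c (fst \<alpha>) (snd \<alpha>) * d (fst \<gamma>) (snd \<gamma>)) *
          M (\<lambda>i. fst \<alpha> i + fst \<gamma> i) (snd \<alpha> + snd \<gamma>) z)" for z
  proof -
    have "indicator solid_cone z *\<^sub>R (p (fst z) (snd z) * q (fst z) (snd z) * weight \<beta> \<mu> (fst z) (snd z))
      = (\<Sum>\<alpha>\<in>?I m. \<Sum>\<gamma>\<in>?I m'. (c (fst \<alpha>) (snd \<alpha>) * mpow (fst z) (fst \<alpha>) * snd z ^ snd \<alpha>)
          * (d (fst \<gamma>) (snd \<gamma>) * mpow (fst z) (fst \<gamma>) * snd z ^ snd \<gamma>))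
        * (indicator solid_cone z * weight \<beta> \<mu> (fst z) (snd z))"
      unfolding c d split_beta sum_product[symmetric] by (simp only: real_scaleR_def mult_ac)
    also have "\<dots> = (\<Sum>\<alpha>\<in>?I m. \<Sum>\<gamma>\<in>?I m'. (c (fst \<alpha>) (snd \<alpha>) * d (fst \<gamma>) (snd \<gamma>)) *
          M (\<lambda>i. fst \<alpha> i + fst \<gamma> i) (snd \<alpha> + snd \<gamma>) z)"
      unfolding sum_distrib_right M_def mpow_add power_add real_scaleR_def
      by (intro sum.cong[OF refl]) (simp only: mult_ac)
    finally show ?thesis .
  qed
  then show ?thesis
    by (simp only:) (intro Bochner_Integration.integrable_sum integrable_mult_right M)
qed

lemma weight_inner_commute: "weight_inner \<beta> \<mu> p q = weight_inner \<beta> \<mu> q p"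
  unfolding weight_inner_def by (simp only: mult.commute[of "p _ _"])

lemma weight_inner_lincomb:
  fixes p q r :: "real^'n \<Rightarrow> real \<Rightarrow> real"
  assumes \<mu>: "\<mu> > - 1/2" and pos: "2 * \<mu> + \<beta> + real CARD('n) > 0"
    and p: "p \<in> polys_deg_less m" and q: "q \<in> polys_deg_less m" and r: "r \<in> polys_deg_less m'"
  shows "weight_inner \<beta> \<mu> (\<lambda>x t. p x t + c * q x t) r = weight_inner \<beta> \<mu> p r + c * weight_inner \<beta> \<mu> q r"
proof -
  let ?f = "\<lambda>p z. indicator solid_cone z *\<^sub>R (p (fst z) (snd z) * r (fst z) (snd z) * weight \<beta> \<mu> (fst z) (snd z))"
  have "(\<lambda>z. ?f (\<lambda>x t. p x t + c * q x t) z) = (\<lambda>z. ?f p z + c * ?f q z)"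
    by (auto simp: fun_eq_iff algebra_simps)
  then show ?thesis
    using integrable_polys_weight[OF \<mu> pos p r] integrable_polys_weight[OF \<mu> pos q r]
    unfolding weight_inner_def cone_integral_def set_lebesgue_integral_def by simp
qed

text \<open>The integrand is nonnegative, so it is zero almost everywhere. The interior points where
  p is nonzero form an open null set, which is empty; vanishing on the open cone then determines
  p.\<close>

lemma weight_inner_definite:
  fixes p :: "real^'n \<Rightarrow> real \<Rightarrow> real"
  assumes \<mu>: "\<mu> > - 1/2" and pos: "2 * \<mu> + \<beta> + real CARD('n) > 0"
    and p: "p \<in> polys_deg_less m" and zero: "weight_inner \<beta> \<mu> p p = 0"
  shows "p x t = 0"
proof -
  define U where "U = {z. norm (fst z) < snd z} \<inter> (\<lambda>z. p (fst z) (snd z)) -` (- {0})"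
  let ?f = "\<lambda>z. indicator solid_cone z *\<^sub>R (p (fst z) (snd z) * p (fst z) (snd z) * weight \<beta> \<mu> (fst z) (snd z))"
  have "open {z :: (real^'n) \<times> real. norm (fst z) < snd z}"
    by (intro open_Collect_less continuous_intros)
  then have "open U"
    unfolding U_def by (rule continuous_open_preimage[OF continuous_on_polys[OF p]]) auto
  have "(LINT z|lborel. ?f z) = 0"
    using zero by (simp add: weight_inner_def cone_integral_def set_lebesgue_integral_def)
  moreover have "0 \<le> ?f z" for z
    by (simp add: weight_def)
  ultimately have "AE z in lborel. ?f z = 0"
    using integral_nonneg_eq_0_iff_AE[OF integrable_polys_weight[OF \<mu> pos p p]] by simp
  then have "AE z in lborel. z \<notin> U"
  proof eventually_elim
    case (elim z)
    show ?case
    proof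
      assume z: "z \<in> U"
      then have "norm (fst z) < snd z" by (simp add: U_def)
      then have "weight \<beta> \<mu> (fst z) (snd z) \<noteq> 0" and "z \<in> solid_cone"
        using weight_pos[of "fst z" "snd z" \<beta> \<mu>] by (auto simp: solid_cone_def split_beta)
      then show False using elim z by (simp add: U_def)
    qed
  qed
  then have "U \<in> null_sets lborel"
    using \<open>open U\<close> by (subst AE_iff_null_sets) auto
  then have "negligible U"
    using negligible_iff_null_sets null_sets_completionI by blast
  then have "U = {}"
    using open_not_negligible[OF \<open>open U\<close>] by blast
  then have "(x, t) \<notin> U" for x t by simp
  then have "p x t = 0" if "norm x < t" for x t
    using that by (simp add: U_def)
  then show ?thesis
    by (rule polys_deg_less_vanish_on_cone[OF p])
qed

lemma weight_inner_eq_0_on_monomials: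
  fixes p q :: "real^'n \<Rightarrow> real \<Rightarrow> real"
  assumes \<mu>: "\<mu> > - 1/2" and pos: "2 * \<mu> + \<beta> + real CARD('n) > 0"
    and p: "p \<in> polys_deg_less m'" and q: "q \<in> polys_deg_less m"
    and orth: "\<And>a i. mdeg a + i < m \<Longrightarrow> weight_inner \<beta> \<mu> p (\<lambda>x t. mpow x a * t ^ i) = 0"
  shows "weight_inner \<beta> \<mu> p q = 0"
proof -
  obtain c where c: "\<And>x t. q x t = (\<Sum>(a, i) | mdeg a + i < m. c a i * mpow x a * t ^ i)"
    using polys_deg_lessD[OF q] by blast
  let ?I = "{(a :: 'n \<Rightarrow> nat, i). mdeg a + i < m}"
  let ?f = "\<lambda>a i z. indicator solid_cone z *\<^sub>R (p (fst z) (snd z) * (mpow (fst z) a * snd z ^ i) * weight \<beta> \<mu> (fst z) (snd z))"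
  have int: "integrable lborel (?f a i)" if "mdeg a + i < m" for a i
    using integrable_polys_weight[OF \<mu> pos p monomial_in_polys_deg_less[OF that]] by simp
  have "indicator solid_cone z *\<^sub>R (p (fst z) (snd z) * q (fst z) (snd z) * weight \<beta> \<mu> (fst z) (snd z))
      = (\<Sum>\<alpha>\<in>?I. c (fst \<alpha>) (snd \<alpha>) * ?f (fst \<alpha>) (snd \<alpha>) z)" for z
    unfolding c split_beta sum_distrib_left sum_distrib_right real_scaleR_def
    by (intro sum.cong[OF refl]) (simp only: mult_ac)
  then have "weight_inner \<beta> \<mu> p q = (LINT z|lborel. (\<Sum>\<alpha>\<in>?I. c (fst \<alpha>) (snd \<alpha>) * ?f (fst \<alpha>) (snd \<alpha>) z))"
    unfolding weight_inner_def cone_integral_def set_lebesgue_integral_def by (simp only:)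
  also have "\<dots> = (\<Sum>\<alpha>\<in>?I. LINT z|lborel. c (fst \<alpha>) (snd \<alpha>) * ?f (fst \<alpha>) (snd \<alpha>) z)"
    by (rule Bochner_Integration.integral_sum) (intro integrable_mult_right int, auto)
  also have "\<dots> = (\<Sum>\<alpha>\<in>?I. c (fst \<alpha>) (snd \<alpha>) * weight_inner \<beta> \<mu> p (\<lambda>x t. mpow x (fst \<alpha>) * t ^ snd \<alpha>))"
    unfolding weight_inner_def cone_integral_def set_lebesgue_integral_def
    by (intro sum.cong[OF refl] integral_mult_right_zero)
  also have "\<dots> = 0"
    by (intro sum.neutral) (auto simp: orth)
  finally show ?thesis .
qed

text \<open>\<open>laguerre_V\<close> is a definite description, so existence and uniqueness precede
  any property of it. Existence subtracts from the leading monomial its projection onto the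
  monomials of degree below n.\<close>

lemma laguerre_V_leading_term:
  fixes j :: "'n::finite \<Rightarrow> nat"
  assumes \<mu>: "\<mu> > - 1/2" and pos: "2 * \<mu> + \<beta> + real CARD('n) > 0" and jn: "mdeg j \<le> n"
  shows "(\<lambda>x t. laguerre_V \<beta> \<mu> j n x t - t ^ (n - mdeg j) * mpow x j) \<in> polys_deg_less n"
proof -
  let ?E = "\<lambda>\<alpha> z. mpow (fst z :: real^'n) (fst \<alpha>) * (snd z :: real) ^ snd \<alpha>"
  let ?B = "\<lambda>F G. weight_inner \<beta> \<mu> (\<lambda>x t. F (x, t)) (\<lambda>x t. G (x :: real^'n, t :: real))"
  let ?I = "{(a :: 'n \<Rightarrow> nat, i). mdeg a + i < n}"
  let ?T = "\<lambda>(x :: real^'n) t. t ^ (n - mdeg j) * mpow x j"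
  \<comment> \<open>All polynomials, of any degree, as functions on pairs: there the form is
    bilinear and definite.\<close>
  define X where "X = {F. \<exists>m. (\<lambda>x t. F (x :: real^'n, t :: real)) \<in> polys_deg_less m}"
  have join: "\<exists>m. (\<lambda>x t. f (x, t)) \<in> polys_deg_less m \<and> (\<lambda>x t. g (x, t)) \<in> polys_deg_less m" if "f \<in> X" "g \<in> X" for f g
    using that unfolding X_def by (blast intro: polys_deg_less_mono max.cobounded1 max.cobounded2)
  have T: "?T \<in> polys_deg_less (Suc n)"
    using monomial_in_polys_deg_less[of j "n - mdeg j" "Suc n"] jn by (simp add: mult.commute)
  have "\<exists>c. (\<lambda>z. ?T (fst z) (snd z) - (\<Sum>\<alpha>\<in>?I. c \<alpha> * ?E \<alpha> z)) \<in> X \<and>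
     (\<forall>\<gamma>\<in>?I. ?B (\<lambda>z. ?T (fst z) (snd z) - (\<Sum>\<alpha>\<in>?I. c \<alpha> * ?E \<alpha> z)) (?E \<gamma>) = 0)"
  proof (rule orthogonal_projection_exists[of X ?B ?I ?E "\<lambda>z. ?T (fst z) (snd z)"])
    show "(\<lambda>z. f z + c * g z) \<in> X" if "f \<in> X" "g \<in> X" for f g c
      using join[OF that] unfolding X_def by (auto intro: polys_deg_less_lincomb)
    show "?B (\<lambda>z. f z + c * g z) h = ?B f h + c * ?B g h" if f: "f \<in> X" and g: "g \<in> X" and h: "h \<in> X" for f g h c
    proof -
      obtain m where "(\<lambda>x t. f (x, t)) \<in> polys_deg_less m" "(\<lambda>x t. g (x, t)) \<in> polys_deg_less m"
        using join[OF f g] by blast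
      moreover obtain m' where "(\<lambda>x t. h (x, t)) \<in> polys_deg_less m'" using h by (auto simp: X_def)
      ultimately show ?thesis by (rule weight_inner_lincomb[OF \<mu> pos])
    qed
    show "f = (\<lambda>_. 0)" if f: "f \<in> X" and f0: "?B f f = 0" for f
    proof -
      obtain m where m: "(\<lambda>x t. f (x, t)) \<in> polys_deg_less m" using f by (auto simp: X_def)
      show ?thesis using weight_inner_definite[OF \<mu> pos m f0] by auto
    qed
    show "?E \<alpha> \<in> X" if "\<alpha> \<in> ?I" for \<alpha>
      using that monomial_in_polys_deg_less[of "fst \<alpha>" "snd \<alpha>" n] by (auto simp: X_def)
    show "(\<lambda>z. ?T (fst z) (snd z)) \<in> X"
      using T by (auto simp: X_def)
  qed (rule weight_inner_commute finite_monomials)+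
  then obtain c where c: "\<And>\<gamma>. \<gamma> \<in> ?I \<Longrightarrow> ?B (\<lambda>z. ?T (fst z) (snd z) - (\<Sum>\<alpha>\<in>?I. c \<alpha> * ?E \<alpha> z)) (?E \<gamma>) = 0"
    by blast
  define r where "r x t = (\<Sum>\<alpha>\<in>?I. - c \<alpha> * ?E \<alpha> (x, t))" for x t
  define v where "v x t = ?T x t + 1 * r x t" for x t
  have r: "r \<in> polys_deg_less n"
    by (rule polys_deg_lessI[where c = "\<lambda>a i. - c (a, i)"]) (simp add: r_def split_beta mult.assoc)
  have v1: "v \<in> polys_deg_less (Suc n)"
    unfolding v_def by (rule polys_deg_less_lincomb[OF T polys_deg_less_mono[OF r]]) simp
  have "weight_inner \<beta> \<mu> v (\<lambda>x t. mpow x a * t ^ i) = 0" if "mdeg a + i < n" for a i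
  proof -
    have "v = (\<lambda>x t. ?T x t - (\<Sum>\<alpha>\<in>?I. c \<alpha> * ?E \<alpha> (x, t)))"
      by (auto simp: v_def r_def sum_negf fun_eq_iff)
    then show ?thesis using c[of "(a, i)"] that by simp
  qed
  then have v2: "v \<in> orth_polys \<beta> \<mu> n"
    unfolding orth_polys_def using v1 weight_inner_eq_0_on_monomials[OF \<mu> pos v1] by blast
  have v3: "(\<lambda>x t. v x t - ?T x t) \<in> polys_deg_less n"
    using r by (simp add: v_def)
  have "laguerre_V \<beta> \<mu> j n = v"
    unfolding laguerre_V_def
  proof (rule the_equality)
    show "v \<in> orth_polys \<beta> \<mu> n \<and> (\<lambda>x t. v x t - ?T x t) \<in> polys_deg_less n"
      using v2 v3 ..
    fix u assume u: "u \<in> orth_polys \<beta> \<mu> n \<and> (\<lambda>x t. u x t - ?T x t) \<in> polys_deg_less n"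
    \<comment> \<open>The difference has degree below n, and both candidates are orthogonal to such
      polynomials, so \<open>D\<close> is orthogonal to itself.\<close>
    define D where "D x t = u x t + (- 1) * v x t" for x t
    have D: "D \<in> polys_deg_less n"
      using polys_deg_less_lincomb[OF conjunct2[OF u] v3, of "- 1"] by (simp add: D_def[abs_def])
    have "u \<in> polys_deg_less (Suc n)" and uD: "weight_inner \<beta> \<mu> u D = 0"
      using u D by (auto simp: orth_polys_def)
    moreover have "weight_inner \<beta> \<mu> v D = 0"
      using v2 D by (auto simp: orth_polys_def)
    ultimately have "weight_inner \<beta> \<mu> D D = 0"
      unfolding D_def using weight_inner_lincomb[OF \<mu> pos _ v1 D, of u "- 1"] by (simp add: D_def[abs_def])
    then have "D x t = 0" for x t
      by (rule weight_inner_definite[OF \<mu> pos D])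
    then show "u = v" by (auto simp: D_def fun_eq_iff)
  qed
  then show ?thesis using v3 by simp
qed

section \<open>The normalising constant and the final evaluation\<close>

lemma norm_const_eq:
  assumes \<mu>: "\<mu> > - 1/2" and pos: "2 * \<mu> + \<beta> + real CARD('n::finite) > 0"
  shows "norm_const TYPE('n) \<beta> \<mu>
    = inverse (ball_moment (\<mu> - 1/2) (\<lambda>_::'n. 0) * Gamma (2 * \<mu> + \<beta> + real CARD('n)))"
proof -
  have z: "mpow x (\<lambda>_. 0) = 1" "mdeg (\<lambda>_::'n. 0) = 0" for x :: "real^'n"
    by (simp_all add: mpow_def mdeg_def)
  have "cone_integral (weight \<beta> \<mu> :: real^'n \<Rightarrow> real \<Rightarrow> real)
      = ball_moment (\<mu> - 1/2) (\<lambda>_::'n. 0) * Gamma (2 * \<mu> + \<beta> + real CARD('n))"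
    using has_bochner_integral_weight_monomial[OF \<mu> pos, of "\<lambda>_. 0" 0]
    by (intro cone_integral_eqI) (simp add: z)
  then show ?thesis unfolding norm_const_def by simp
qed

lemma Gamma_plus_nat:
  assumes "(x::real) > 0"
  shows "Gamma (x + real m) = pochhammer x m * Gamma x"
proof -
  have "x \<notin> \<int>\<^sub>\<le>\<^sub>0" using assms by (auto elim!: nonpos_Ints_cases)
  then show ?thesis
    using pochhammer_Gamma[of x m] Gamma_real_pos[OF assms] by simp
qed

lemma ball_moment_0_pos:
  assumes "s > -1"
  shows "ball_moment s (\<lambda>_::'n::finite. 0) > 0"
proof -
  have "gauss_moment 0 = sqrt pi"
    using gauss_moment_even[of 0] by (simp add: gauss_moment_def has_bochner_integral_iff)
  moreover have "s + 1 + (real (mdeg (\<lambda>_::'n. 0)) + real CARD('n)) / 2 > 0"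
    using assms by (simp add: add_pos_nonneg)
  ultimately show ?thesis
    unfolding ball_moment_def using assms by (simp add: Gamma_real_pos)
qed

text \<open>Raising the exponent by m keeps the Gaussian factors and shifts both Gamma arguments by
  m, so one Pochhammer symbol appears above and one below.\<close>

lemma ball_moment_ratio:
  assumes \<mu>: "\<mu> > - 1/2"
  shows "ball_moment (real m + \<mu> - 1/2) (\<lambda>_::'n::finite. 0)
    = ball_moment (\<mu> - 1/2) (\<lambda>_::'n. 0) *
      (pochhammer (\<mu> + 1/2) m / pochhammer (\<mu> + (real CARD('n) + 1) / 2) m)"
proof -
  have m: "mdeg (\<lambda>_::'n. 0) = 0" by (simp add: mdeg_def)
  have p1: "\<mu> + 1/2 > 0" and p2: "\<mu> + (real CARD('n) + 1) / 2 > 0" using \<mu> by (simp_all add: field_simps)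
  have g1: "Gamma (\<mu> + 1/2 + real m) = pochhammer (\<mu> + 1/2) m * Gamma (\<mu> + 1/2)"
    by (rule Gamma_plus_nat[OF p1])
  have g2: "Gamma (\<mu> + (real CARD('n) + 1) / 2 + real m)
     = pochhammer (\<mu> + (real CARD('n) + 1) / 2) m * Gamma (\<mu> + (real CARD('n) + 1) / 2)"
    by (rule Gamma_plus_nat[OF p2])
  have e: "real m + \<mu> - 1/2 + 1 = \<mu> + 1/2 + real m" "\<mu> - 1/2 + 1 = \<mu> + 1/2"
    "\<mu> + 1/2 + real m + (real 0 + real CARD('n)) / 2 = \<mu> + (real CARD('n) + 1) / 2 + real m"
    "\<mu> + 1/2 + (real 0 + real CARD('n)) / 2 = \<mu> + (real CARD('n) + 1) / 2"
    by (simp_all add: field_simps)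
  show ?thesis
    unfolding ball_moment_def m e g1 g2 by (simp add: mult_ac)
qed

theorem proposition4p3:
  fixes \<beta> \<mu> :: real and k j :: "'n::finite \<Rightarrow> nat" and n :: nat
  assumes "\<mu> > - 1/2"
    and "\<beta> > - real CARD('n)"
    and "2 * \<mu> + \<beta> + real CARD('n) > 0"
    and "mdeg k \<le> n" and "mdeg j \<le> n"
    and "mdeg k \<ge> mdeg j \<or> (mdeg j > mdeg k \<and> (\<exists>i. odd (int (j i) - int (k i))))"
  shows "norm_const TYPE('n) \<beta> \<mu>
           * cone_integral (\<lambda>x t. laguerre_U \<beta> \<mu> k n x t * laguerre_V \<beta> \<mu> j n x t * weight \<beta> \<mu> x t)
         = real (mfact k) * fact (n - mdeg k) * (- 1) ^ n
           * pochhammer (2 * \<mu> + \<beta> + real CARD('n)) (n + mdeg k)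
           * (pochhammer (\<mu> + 1/2) (mdeg k)
              / pochhammer (\<mu> + (real CARD('n) + 1) / 2) (mdeg k))
           * (if k = j then 1 else 0)"
proof -
  note \<mu> = assms(1) and pos = assms(3) and kn = assms(4) and jn = assms(5)
  define s where "s = 2 * \<mu> + \<beta> + real CARD('n)"
  define p where "p = real (mdeg k) + \<mu> - 1/2"
  define G where "G = gamma_functional (s + real (mdeg k) + real (mdeg j) + real (n - mdeg j))
     (rodrigues_poly (s + real n + real (mdeg k) - 1) (n - mdeg k))"
  define M where "M = radial_moment p (rodrigues_radial p k) j"
  let ?U = "\<lambda>z. indicator solid_cone z * laguerre_U \<beta> \<mu> k n (fst z) (snd z) * weight \<beta> \<mu> (fst z) (snd z)"
  obtain c where c: "\<And>x t. laguerre_V \<beta> \<mu> j n x t - t ^ (n - mdeg j) * mpow x j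
      = (\<Sum>(a, i) | mdeg a + i < n. c a i * mpow x a * t ^ i)"
    using polys_deg_lessD[OF laguerre_V_leading_term[OF \<mu> pos jn]] by blast
  let ?I = "{(a :: 'n \<Rightarrow> nat, i). mdeg a + i < n}"
  let ?f = "\<lambda>a i z. indicator solid_cone z *\<^sub>R (laguerre_U \<beta> \<mu> k n (fst z) (snd z) * (mpow (fst z) a * snd z ^ i) * weight \<beta> \<mu> (fst z) (snd z))"
  have V: "laguerre_V \<beta> \<mu> j n x t = mpow x j * t ^ (n - mdeg j) + (\<Sum>\<alpha>\<in>?I. c (fst \<alpha>) (snd \<alpha>) * mpow x (fst \<alpha>) * t ^ snd \<alpha>)" for x t
    using c[of x t] by (simp add: split_beta algebra_simps)
  \<comment> \<open>\<open>laguerre_U\<close> enters only through its integrals against monomials,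
    and each lower term of the expansion of V contributes zero.\<close>
  have lower: "has_bochner_integral lborel (\<lambda>z. \<Sum>\<alpha>\<in>?I. c (fst \<alpha>) (snd \<alpha>) * ?f (fst \<alpha>) (snd \<alpha>) z)
      (\<Sum>\<alpha>\<in>?I. c (fst \<alpha>) (snd \<alpha>) * 0)"
    by (intro has_bochner_integral_sum has_bochner_integral_mult_right laguerre_U_monomial_eq_0[OF \<mu> pos kn]) auto
  have top: "has_bochner_integral lborel (?f j (n - mdeg j)) (M * G)"
    using has_bochner_integral_laguerre_U_monomial[OF \<mu> pos kn, of j "n - mdeg j"]
    unfolding s_def[symmetric] p_def[symmetric] M_def[symmetric] G_def[symmetric] .
  have "cone_integral (\<lambda>x t. laguerre_U \<beta> \<mu> k n x t * laguerre_V \<beta> \<mu> j n x t * weight \<beta> \<mu> x t)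
      = M * G + (\<Sum>\<alpha>\<in>?I. c (fst \<alpha>) (snd \<alpha>) * 0)"
  proof (rule cone_integral_eqI)
    have "indicator solid_cone z *\<^sub>R (laguerre_U \<beta> \<mu> k n (fst z) (snd z) * laguerre_V \<beta> \<mu> j n (fst z) (snd z) * weight \<beta> \<mu> (fst z) (snd z))
       = ?f j (n - mdeg j) z + (\<Sum>\<alpha>\<in>?I. c (fst \<alpha>) (snd \<alpha>) * ?f (fst \<alpha>) (snd \<alpha>) z)" for z
    proof -
      have "(\<Sum>\<alpha>\<in>?I. c (fst \<alpha>) (snd \<alpha>) * ?f (fst \<alpha>) (snd \<alpha>) z)
        = ?U z * (\<Sum>\<alpha>\<in>?I. c (fst \<alpha>) (snd \<alpha>) * mpow (fst z) (fst \<alpha>) * snd z ^ snd \<alpha>)"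
        unfolding sum_distrib_left real_scaleR_def by (intro sum.cong[OF refl]) (simp only: mult_ac)
      then show ?thesis unfolding V by (simp add: algebra_simps)
    qed
    then show "has_bochner_integral lborel
        (\<lambda>z. indicator solid_cone z *\<^sub>R (laguerre_U \<beta> \<mu> k n (fst z) (snd z) * laguerre_V \<beta> \<mu> j n (fst z) (snd z) * weight \<beta> \<mu> (fst z) (snd z)))
        (M * G + (\<Sum>\<alpha>\<in>?I. c (fst \<alpha>) (snd \<alpha>) * 0))"
      using has_bochner_integral_add[OF top lower] by (simp only:)
  qed
  then have int: "cone_integral (\<lambda>x t. laguerre_U \<beta> \<mu> k n x t * laguerre_V \<beta> \<mu> j n x t * weight \<beta> \<mu> x t) = M * G"
    by simp
  have M: "M = (- 1) ^ mdeg k * real (mfact k) * (\<Prod>i\<in>UNIV. real (j i choose k i)) * ball_moment p (\<lambda>i. j i - k i)"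
    unfolding M_def using \<mu> by (intro radial_moment_rodrigues) (simp add: p_def)
  show ?thesis
  proof (cases "k = j")
    case True
    have P: "ball_moment (\<mu> - 1/2) (\<lambda>_::'n. 0) > 0"
      using \<mu> by (intro ball_moment_0_pos) simp
    have s: "s > 0" using pos by (simp add: s_def)
    \<comment> \<open>For k = j the binomial coefficients are 1 and the remaining monomial is
      constant, so only the change of exponent from \<mu> - 1/2 to \<open>p\<close> is left.\<close>
    have M': "M = (- 1) ^ mdeg k * real (mfact k) * (ball_moment (\<mu> - 1/2) (\<lambda>_::'n. 0) *
      (pochhammer (\<mu> + 1/2) (mdeg k) / pochhammer (\<mu> + (real CARD('n) + 1) / 2) (mdeg k)))"
      unfolding M p_def using ball_moment_ratio[OF \<mu>, where 'n = 'n and m = "mdeg k"] True by simp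
    have e: "s + real (mdeg k) + real (mdeg j) + real (n - mdeg j) = s + real n + real (mdeg k)"
      using True kn by (simp add: of_nat_diff)
    have "G = (- 1) ^ (n - mdeg k) * fact (n - mdeg k) * Gamma (s + real n + real (mdeg k))"
      unfolding G_def e using gamma_functional_rodrigues_poly_top[of "s + real n + real (mdeg k) - 1"] s by simp
    moreover have "Gamma (s + real n + real (mdeg k)) = pochhammer s (n + mdeg k) * Gamma s"
      using Gamma_plus_nat[OF s, of "n + mdeg k"] by (simp add: add.assoc)
    moreover have "(- 1 :: real) ^ n = (- 1) ^ mdeg k * (- 1) ^ (n - mdeg k)"
      using kn by (simp flip: power_add)
    ultimately show ?thesis
      unfolding int norm_const_eq[OF \<mu> pos] s_def[symmetric] M' using P Gamma_real_pos[OF s] True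
      by (simp add: field_simps)
  next
    case False
    have "M = 0"
    proof (cases "\<forall>i. k i \<le> j i")
      case False
      then obtain i where "j i < k i" by (auto simp: not_le)
      then have "(\<Prod>i\<in>UNIV. real (j i choose k i)) = 0" by (auto intro!: exI[of _ i] simp: binomial_eq_0)
      then show ?thesis by (simp add: M)
    next
      case True
      \<comment> \<open>Since k \<le> j componentwise and k \<noteq> j, one has |k| < |j|, which
        leaves only the parity alternative of the hypothesis.\<close>
      obtain i0 where "k i0 < j i0" using True \<open>k \<noteq> j\<close> by (metis ext le_neq_implies_less)
      then have "mdeg k < mdeg j"
        unfolding mdeg_def using True by (intro sum_strict_mono_ex1) auto
      then obtain i where "odd (int (j i) - int (k i))" using assms(6) by auto
      moreover have "int (j i) - int (k i) = int (j i - k i)" using True by (simp add: of_nat_diff)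
      ultimately have "odd (int (j i - k i))" by (simp only: not_False_eq_True)
      then have "odd (j i - k i)" by (simp only: even_of_nat not_False_eq_True)
      then show ?thesis unfolding M using ball_moment_eq_0[of "\<lambda>i. j i - k i" i] by simp
    qed
    then show ?thesis using int False by simp
  qed
qed

end
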